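(* A totally umbilical hypersurface $M^m$ in an Einstein space $(N^{m+1},h)$ with non-positive scalar curvature is biharmonic if and only if it is minimal.
   Context: All manifolds, maps and tensor fields are smooth. A map $\varphi:(M,g)\to(N,h)$ between Riemannian manifolds has tension field $\tau(\varphi)=\mathrm{Trace}_g\nabla d\varphi$. It is biharmonic if it is a critical point of the bienergy $E^2(\varphi,\Omega)=\frac12\int_\Omega|\tau(\varphi)|^2dx$ for every compact $\Omega\subset M$; equivalently, its bitension field $$\tau^2(\varphi)=\mathrm{Trace}_g(\nabla^\varphi\nabla^\varphi-\nabla^\varphi_{\nabla^M})\tau(\varphi)-\mathrm{Trace}_g R^N(d\varphi,\tau(\varphi))d\varphi$$ vanishes identically, where $R^N(X,Y)Z=[\nabla^N_X,\nabla^N_Y]Z-\nabla^N_{[X,Y]}Z$. A hypersurface (codimension-one isometric immersion) is called biharmonic if its inclusion map (the isometric immersion) is biharmonic. An Einstein space $(N^{m+1},h)$ satisfies $\mathrm{Ric}^N=\frac{r}{m+1}h$ with $r$ the scalar curvature. A hypersurface is totally umbilical if at each point $p$ all its principal curvatures are equal to the same number $\lambda(p)$. It is minimal if its mean curvature function $H=\frac1m\mathrm{trace}\,A$ ($A$ the shape operator) vanishes identically. *)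

theory Defs
  imports "HOL-Analysis.Analysis"
begin

section \<open>Smooth maps between open subsets of normed spaces\<close>

fun times_differentiable_on ::
    "nat \<Rightarrow> 'a::real_normed_vector set \<Rightarrow> ('a \<Rightarrow> 'b::real_normed_vector) \<Rightarrow> bool" where
  "times_differentiable_on 0 S f \<longleftrightarrow> continuous_on S f"
| "times_differentiable_on (Suc k) S f \<longleftrightarrow>
     (\<forall>x\<in>S. f differentiable (at x)) \<and>
     (\<forall>v. times_differentiable_on k S (\<lambda>x. frechet_derivative f (at x) v))"

text \<open>Used for open \<open>S\<close> only.\<close>

definition smooth_on ::
    "'a::real_normed_vector set \<Rightarrow> ('a \<Rightarrow> 'b::real_normed_vector) \<Rightarrow> bool" where
  "smooth_on S f \<longleftrightarrow> (\<forall>k. times_differentiable_on k S f)"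


section \<open>Riemannian manifolds\<close>

text \<open>
  A chart is a coordinate neighbourhood together with its coordinate map. A Riemannian manifold
  of dimension \<open>CARD('n)\<close> is given by a topology, a smooth atlas (not necessarily
  maximal), and, for every chart \<open>c\<close> of the atlas, the matrix of components of the metric
  as a function of the coordinates; the value of \<open>metric M c x\<close> matters only for
  \<open>c\<close> in the atlas and \<open>x\<close> in the image of \<open>c\<close>.
\<close>

type_synonym ('a, 'n) chart = "'a set \<times> ('a \<Rightarrow> real ^ 'n)"

record ('a, 'n::finite) riemannian =
  topology_of :: "'a topology"
  atlas :: "('a, 'n) chart set"
  metric :: "('a, 'n) chart \<Rightarrow> real ^ 'n \<Rightarrow> real ^ 'n ^ 'n"

definition chart_dom :: "('a, 'n::finite) chart \<Rightarrow> 'a set" where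
  "chart_dom c = fst c"

definition chart_map :: "('a, 'n::finite) chart \<Rightarrow> 'a \<Rightarrow> real ^ 'n" where
  "chart_map c = snd c"

definition chart_image :: "('a, 'n::finite) chart \<Rightarrow> (real ^ 'n) set" where
  "chart_image c = chart_map c ` chart_dom c"

definition chart_inv :: "('a, 'n::finite) chart \<Rightarrow> real ^ 'n \<Rightarrow> 'a" where
  "chart_inv c = inv_into (chart_dom c) (chart_map c)"

definition is_chart :: "'a topology \<Rightarrow> ('a, 'n::finite) chart \<Rightarrow> bool" where
  "is_chart X c \<longleftrightarrow> openin X (chart_dom c) \<and> open (chart_image c) \<and>
     homeomorphic_map (subtopology X (chart_dom c)) (top_of_set (chart_image c)) (chart_map c)"

text \<open>
  \<open>local_rep c d \<phi>\<close> is the coordinate expression \<open>d \<circ> \<phi> \<circ> c\<^sup>-\<^sup>1\<close> of a map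
  \<open>\<phi>\<close>; it is meaningful on \<open>local_dom c d \<phi>\<close>. For \<open>\<phi> = id\<close> it is the
  transition map from \<open>c\<close> to \<open>d\<close>.
\<close>

definition local_dom ::
    "('a, 'm::finite) chart \<Rightarrow> ('b, 'n::finite) chart \<Rightarrow> ('a \<Rightarrow> 'b) \<Rightarrow> (real ^ 'm) set" where
  "local_dom c d \<phi> = chart_map c ` (chart_dom c \<inter> \<phi> -` chart_dom d)"

definition local_rep ::
    "('a, 'm::finite) chart \<Rightarrow> ('b, 'n::finite) chart \<Rightarrow> ('a \<Rightarrow> 'b) \<Rightarrow> real ^ 'm \<Rightarrow> real ^ 'n" where
  "local_rep c d \<phi> = chart_map d \<circ> \<phi> \<circ> chart_inv c"

text \<open>Components of the pull-back of the bilinear form field \<open>H\<close> by \<open>f\<close>.\<close>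

definition pullback ::
    "(real ^ 'n \<Rightarrow> real ^ 'n ^ 'n) \<Rightarrow> (real ^ 'm \<Rightarrow> real ^ 'n) \<Rightarrow> real ^ 'm \<Rightarrow> real ^ 'm ^ 'm" where
  "pullback H f x = transpose (jacobian f (at x)) ** H (f x) ** jacobian f (at x)"

definition riemannian_manifold :: "('a, 'n::finite) riemannian \<Rightarrow> bool" where
  "riemannian_manifold M \<longleftrightarrow>
     Hausdorff_space (topology_of M) \<and> second_countable (topology_of M) \<and>
     (\<forall>c\<in>atlas M. is_chart (topology_of M) c) \<and>
     (\<Union>c\<in>atlas M. chart_dom c) = topspace (topology_of M) \<and>
     (\<forall>c\<in>atlas M. \<forall>d\<in>atlas M. smooth_on (local_dom c d id) (local_rep c d id)) \<and>
     (\<forall>c\<in>atlas M. smooth_on (chart_image c) (metric M c) \<and>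
        (\<forall>x\<in>chart_image c. transpose (metric M c x) = metric M c x \<and>
           (\<forall>v. v \<noteq> 0 \<longrightarrow> 0 < v \<bullet> (metric M c x *v v)))) \<and>
     (\<forall>c\<in>atlas M. \<forall>d\<in>atlas M. \<forall>x\<in>local_dom c d id.
        metric M c x = pullback (metric M d) (local_rep c d id) x)"

definition smooth_map ::
    "('a, 'm::finite) riemannian \<Rightarrow> ('b, 'n::finite) riemannian \<Rightarrow> ('a \<Rightarrow> 'b) \<Rightarrow> bool" where
  "smooth_map M N \<phi> \<longleftrightarrow> continuous_map (topology_of M) (topology_of N) \<phi> \<and>
     (\<forall>c\<in>atlas M. \<forall>d\<in>atlas N. smooth_on (local_dom c d \<phi>) (local_rep c d \<phi>))"

text \<open>
  \<open>g = \<phi>\<^sup>*h\<close>. Since \<open>g\<close> is positive definite, this makes the differential injective, so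
  \<open>\<phi>\<close> is automatically an immersion.
\<close>

definition isometric_immersion ::
    "('a, 'm::finite) riemannian \<Rightarrow> ('b, 'n::finite) riemannian \<Rightarrow> ('a \<Rightarrow> 'b) \<Rightarrow> bool" where
  "isometric_immersion M N \<phi> \<longleftrightarrow> smooth_map M N \<phi> \<and>
     (\<forall>c\<in>atlas M. \<forall>d\<in>atlas N. \<forall>x\<in>local_dom c d \<phi>.
        metric M c x = pullback (metric N d) (local_rep c d \<phi>) x)"

definition hypersurface ::
    "('a, 'm::finite) riemannian \<Rightarrow> ('b, 'n::finite) riemannian \<Rightarrow> ('a \<Rightarrow> 'b) \<Rightarrow> bool" where
  "hypersurface M N \<phi> \<longleftrightarrow> CARD('n) = CARD('m) + 1 \<and> isometric_immersion M N \<phi>"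


section \<open>Tensor calculus in coordinates\<close>

definition partial :: "'m::finite \<Rightarrow> (real ^ 'm \<Rightarrow> 'b::real_normed_vector) \<Rightarrow> real ^ 'm \<Rightarrow> 'b" where
  "partial i f x = frechet_derivative f (at x) (axis i 1)"

text \<open>\<open>christoffel G x k i j\<close> is \<open>\<Gamma>\<^sup>k\<^sub>i\<^sub>j\<close>, that is \<open>\<nabla>\<^bsub>\<partial>\<^sub>i\<^esub> \<partial>\<^sub>j = \<Sum>\<^sub>k \<Gamma>\<^sup>k\<^sub>i\<^sub>j \<partial>\<^sub>k\<close>.\<close>

definition christoffel ::
    "(real ^ 'n \<Rightarrow> real ^ 'n ^ 'n) \<Rightarrow> real ^ 'n \<Rightarrow> 'n::finite \<Rightarrow> 'n \<Rightarrow> 'n \<Rightarrow> real" where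
  "christoffel G x k i j = (1 / 2) * (\<Sum>l\<in>UNIV. matrix_inv (G x) $ k $ l *
     (partial i (\<lambda>y. G y $ j $ l) x + partial j (\<lambda>y. G y $ i $ l) x
      - partial l (\<lambda>y. G y $ i $ j) x))"

text \<open>
  \<open>riem G x l k i j\<close> is \<open>R\<^sup>l\<^sub>k\<^sub>i\<^sub>j\<close>, with
  \<open>R(\<partial>\<^sub>i, \<partial>\<^sub>j)\<partial>\<^sub>k = \<nabla>\<^sub>i\<nabla>\<^sub>j\<partial>\<^sub>k - \<nabla>\<^sub>j\<nabla>\<^sub>i\<partial>\<^sub>k = \<Sum>\<^sub>l R\<^sup>l\<^sub>k\<^sub>i\<^sub>j \<partial>\<^sub>l\<close>;
  \<open>curvature G x u v w\<close> is the vector \<open>R(u, v)w\<close>.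
\<close>

definition riem ::
    "(real ^ 'n \<Rightarrow> real ^ 'n ^ 'n) \<Rightarrow> real ^ 'n \<Rightarrow> 'n::finite \<Rightarrow> 'n \<Rightarrow> 'n \<Rightarrow> 'n \<Rightarrow> real" where
  "riem G x l k i j =
     partial i (\<lambda>y. christoffel G y l j k) x - partial j (\<lambda>y. christoffel G y l i k) x
     + (\<Sum>s\<in>UNIV. christoffel G x l i s * christoffel G x s j k
                 - christoffel G x l j s * christoffel G x s i k)"

definition curvature ::
    "(real ^ 'n \<Rightarrow> real ^ 'n ^ 'n) \<Rightarrow> real ^ 'n \<Rightarrow> real ^ 'n \<Rightarrow> real ^ 'n \<Rightarrow> real ^ 'n \<Rightarrow> real ^ 'n" where
  "curvature G x u v w =
     (\<chi> l. \<Sum>i\<in>UNIV. \<Sum>j\<in>UNIV. \<Sum>k\<in>UNIV. riem G x l k i j * u $ i * v $ j * w $ k)"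

text \<open>\<open>Ric(Y, Z)\<close> is the trace of \<open>X \<mapsto> R(X, Y)Z\<close>.\<close>

definition ricci ::
    "(real ^ 'n \<Rightarrow> real ^ 'n ^ 'n) \<Rightarrow> real ^ 'n \<Rightarrow> real ^ 'n ^ 'n" where
  "ricci G x = (\<chi> j k. \<Sum>i\<in>UNIV. riem G x i k i j)"

definition scalar_curvature ::
    "(real ^ 'n \<Rightarrow> real ^ 'n ^ 'n) \<Rightarrow> real ^ 'n \<Rightarrow> real" where
  "scalar_curvature G x = (\<Sum>j\<in>UNIV. \<Sum>k\<in>UNIV. matrix_inv (G x) $ j $ k * ricci G x $ j $ k)"

definition einstein_space :: "('b, 'n::finite) riemannian \<Rightarrow> bool" where
  "einstein_space N \<longleftrightarrow> riemannian_manifold N \<and>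
     (\<forall>d\<in>atlas N. \<forall>y\<in>chart_image d.
        ricci (metric N d) y =
          (scalar_curvature (metric N d) y / real CARD('n)) *\<^sub>R metric N d y)"

definition nonpositive_scalar_curvature :: "('b, 'n::finite) riemannian \<Rightarrow> bool" where
  "nonpositive_scalar_curvature N \<longleftrightarrow>
     (\<forall>d\<in>atlas N. \<forall>y\<in>chart_image d. scalar_curvature (metric N d) y \<le> 0)"


section \<open>Maps between Riemannian manifolds in coordinates\<close>

text \<open>
  Below, \<open>G\<close> and \<open>H\<close> are the metric components on source and target,
  \<open>f\<close> is the coordinate expression of the map, so that \<open>partial i f x\<close> is the
  vector \<open>df(\<partial>\<^sub>i)\<close> at \<open>f x\<close>, and a section \<open>V\<close> of the pulled-back tangent bundle
  is given by its components with respect to the coordinate frame of the target.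
\<close>

text \<open>The pull-back connection \<open>\<nabla>\<^sup>f\<^bsub>\<partial>\<^sub>i\<^esub> V\<close>.\<close>

definition cov_along ::
    "(real ^ 'n \<Rightarrow> real ^ 'n ^ 'n) \<Rightarrow> (real ^ 'm \<Rightarrow> real ^ 'n) \<Rightarrow> 'm::finite \<Rightarrow>
     (real ^ 'm \<Rightarrow> real ^ 'n) \<Rightarrow> real ^ 'm \<Rightarrow> real ^ 'n" where
  "cov_along H f i V x = partial i V x +
     (\<chi> a. \<Sum>b\<in>UNIV. \<Sum>c\<in>UNIV. christoffel H (f x) a b c * partial i f x $ b * V x $ c)"

text \<open>
  The second fundamental form
  \<open>(\<nabla>df)(\<partial>\<^sub>i, \<partial>\<^sub>j) = \<nabla>\<^sup>f\<^bsub>\<partial>\<^sub>i\<^esub> (df \<partial>\<^sub>j) - df(\<nabla>\<^bsub>\<partial>\<^sub>i\<^esub> \<partial>\<^sub>j)\<close>.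
\<close>

definition second_ff ::
    "(real ^ 'm \<Rightarrow> real ^ 'm ^ 'm) \<Rightarrow> (real ^ 'n \<Rightarrow> real ^ 'n ^ 'n) \<Rightarrow>
     (real ^ 'm \<Rightarrow> real ^ 'n) \<Rightarrow> real ^ 'm \<Rightarrow> 'm::finite \<Rightarrow> 'm \<Rightarrow> real ^ 'n" where
  "second_ff G H f x i j = cov_along H f i (partial j f) x
     - (\<Sum>k\<in>UNIV. christoffel G x k i j *\<^sub>R partial k f x)"

definition tension ::
    "(real ^ 'm \<Rightarrow> real ^ 'm ^ 'm) \<Rightarrow> (real ^ 'n \<Rightarrow> real ^ 'n ^ 'n) \<Rightarrow>
     (real ^ 'm \<Rightarrow> real ^ 'n) \<Rightarrow> real ^ 'm \<Rightarrow> real ^ 'n" where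
  "tension G H f x =
     (\<Sum>i\<in>UNIV. \<Sum>j\<in>UNIV. matrix_inv (G x) $ i $ j *\<^sub>R second_ff G H f x i j)"

definition bitension ::
    "(real ^ 'm \<Rightarrow> real ^ 'm ^ 'm) \<Rightarrow> (real ^ 'n \<Rightarrow> real ^ 'n ^ 'n) \<Rightarrow>
     (real ^ 'm \<Rightarrow> real ^ 'n) \<Rightarrow> real ^ 'm \<Rightarrow> real ^ 'n" where
  "bitension G H f x =
     (let \<tau> = tension G H f in
       (\<Sum>i\<in>UNIV. \<Sum>j\<in>UNIV. matrix_inv (G x) $ i $ j *\<^sub>R
          (cov_along H f i (cov_along H f j \<tau>) x
           - (\<Sum>k\<in>UNIV. christoffel G x k i j *\<^sub>R cov_along H f k \<tau> x)))
     - (\<Sum>i\<in>UNIV. \<Sum>j\<in>UNIV. matrix_inv (G x) $ i $ j *\<^sub>R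
          curvature H (f x) (partial i f x) (\<tau> x) (partial j f x)))"

text \<open>
  The Euler-Lagrange form of biharmonicity: the bitension field vanishes at every point, in all
  charts of the two atlases.
\<close>

definition biharmonic ::
    "('a, 'm::finite) riemannian \<Rightarrow> ('b, 'n::finite) riemannian \<Rightarrow> ('a \<Rightarrow> 'b) \<Rightarrow> bool" where
  "biharmonic M N \<phi> \<longleftrightarrow> smooth_map M N \<phi> \<and>
     (\<forall>c\<in>atlas M. \<forall>d\<in>atlas N. \<forall>x\<in>local_dom c d \<phi>.
        bitension (metric M c) (metric N d) (local_rep c d \<phi>) x = 0)"


section \<open>Extrinsic geometry of hypersurfaces\<close>

definition unit_normal ::
    "(real ^ 'n \<Rightarrow> real ^ 'n ^ 'n) \<Rightarrow> (real ^ 'm::finite \<Rightarrow> real ^ 'n) \<Rightarrow>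
     real ^ 'm \<Rightarrow> real ^ 'n \<Rightarrow> bool" where
  "unit_normal H f x \<xi> \<longleftrightarrow>
     (\<forall>i. partial i f x \<bullet> (H (f x) *v \<xi>) = 0) \<and> \<xi> \<bullet> (H (f x) *v \<xi>) = 1"

text \<open>
  The matrix of the shape operator \<open>A\<close> with respect to the unit normal \<open>\<xi>\<close>, determined by
  \<open>g(A X, Y) = h((\<nabla>df)(X, Y), \<xi>)\<close>. Replacing \<open>\<xi>\<close> by \<open>-\<xi>\<close> changes the sign of \<open>A\<close>, so the
  notions below quantify over both unit normals at a point and need no orientation.
\<close>

definition shape_operator ::
    "(real ^ 'm \<Rightarrow> real ^ 'm ^ 'm) \<Rightarrow> (real ^ 'n \<Rightarrow> real ^ 'n ^ 'n) \<Rightarrow>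
     (real ^ 'm \<Rightarrow> real ^ 'n) \<Rightarrow> real ^ 'm::finite \<Rightarrow> real ^ 'n \<Rightarrow> real ^ 'm ^ 'm" where
  "shape_operator G H f x \<xi> =
     matrix_inv (G x) ** (\<chi> i j. second_ff G H f x i j \<bullet> (H (f x) *v \<xi>))"

definition principal_curvatures ::
    "(real ^ 'm \<Rightarrow> real ^ 'm ^ 'm) \<Rightarrow> (real ^ 'n \<Rightarrow> real ^ 'n ^ 'n) \<Rightarrow>
     (real ^ 'm \<Rightarrow> real ^ 'n) \<Rightarrow> real ^ 'm::finite \<Rightarrow> real ^ 'n \<Rightarrow> real set" where
  "principal_curvatures G H f x \<xi> =
     {\<kappa>. \<exists>v. v \<noteq> 0 \<and> shape_operator G H f x \<xi> *v v = \<kappa> *\<^sub>R v}"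

definition mean_curvature ::
    "(real ^ 'm \<Rightarrow> real ^ 'm ^ 'm) \<Rightarrow> (real ^ 'n \<Rightarrow> real ^ 'n ^ 'n) \<Rightarrow>
     (real ^ 'm \<Rightarrow> real ^ 'n) \<Rightarrow> real ^ 'm::finite \<Rightarrow> real ^ 'n \<Rightarrow> real" where
  "mean_curvature G H f x \<xi> = trace (shape_operator G H f x \<xi>) / real CARD('m)"

definition totally_umbilical ::
    "('a, 'm::finite) riemannian \<Rightarrow> ('b, 'n::finite) riemannian \<Rightarrow> ('a \<Rightarrow> 'b) \<Rightarrow> bool" where
  "totally_umbilical M N \<phi> \<longleftrightarrow>
     (\<forall>c\<in>atlas M. \<forall>d\<in>atlas N. \<forall>x\<in>local_dom c d \<phi>. \<forall>\<xi>.
        unit_normal (metric N d) (local_rep c d \<phi>) x \<xi> \<longrightarrow>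
        (\<exists>l. \<forall>\<kappa>\<in>principal_curvatures (metric M c) (metric N d) (local_rep c d \<phi>) x \<xi>.
           \<kappa> = l))"

definition minimal ::
    "('a, 'm::finite) riemannian \<Rightarrow> ('b, 'n::finite) riemannian \<Rightarrow> ('a \<Rightarrow> 'b) \<Rightarrow> bool" where
  "minimal M N \<phi> \<longleftrightarrow>
     (\<forall>c\<in>atlas M. \<forall>d\<in>atlas N. \<forall>x\<in>local_dom c d \<phi>. \<forall>\<xi>.
        unit_normal (metric N d) (local_rep c d \<phi>) x \<xi> \<longrightarrow>
        mean_curvature (metric M c) (metric N d) (local_rep c d \<phi>) x \<xi> = 0)"

end

theory Submission
  imports Defs
begin

text \<open>
  In a totally umbilical hypersurface the second fundamental form is \<open>(\<tau> / m) g\<close>. Put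
  \<open>u = |\<tau>|\<^sup>2\<close>. Differentiating \<open>h(\<tau>, df(\<partial>\<^sub>j)) = 0\<close> shows that the tangential part of
  \<open>\<nabla>\<^sub>i \<tau>\<close> is \<open>- (u / m) df(\<partial>\<^sub>i)\<close>. In an Einstein space the curvature term of the
  bitension field is \<open>- (r / n) \<tau>\<close>, where \<open>n = m + 1\<close>, hence normal. The tangential part of the bitension
  equation therefore reduces to \<open>(3 / 2m) du = 0\<close>, so \<open>u\<close> is locally constant, and its normal part
  becomes \<open>u\<^sup>2 / m = (r / n) u\<close>. Since \<open>r \<le> 0\<close>, this forces \<open>u = 0\<close>. Pairing with \<open>\<tau>\<close> instead
  of a unit normal field avoids any choice of orientation.
\<close>

subsection \<open>Calculus of smooth functions\<close>

text \<open>Umbilicity only says that the principal curvatures agree with each other. That they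
  exist and determine the second fundamental form comes from its maximum and minimum relative to g:
  both are eigenvalues, so their coincidence leaves no other form than a multiple of g. The function
  u is preferred to its square root, or to a mean curvature function, because it is smooth across
  zeros of \<tau>. Hence du = 0 is available on a whole coordinate domain, and the resulting
  identity for the product of the i-th derivative of \<tau> with \<tau> may be differentiated once
  more at a point where \<tau> is nonzero. The coefficient 3 / 2m is 1/m + 1/(2m). The first summand
  comes from differentiating the factor u of the tangential part, the second from the normal part of
  the derivative of df(\<partial>_k), which is paired with the derivative of \<tau>. Minimality and
  biharmonicity are both conditions on each pair of charts, so the argument stays in fixed
  coordinates throughout.\<close>

lemma times_differentiable_on_cong:
  assumes "open S" "\<And>x. x \<in> S \<Longrightarrow> f x = g x" "times_differentiable_on k S f"
  shows "times_differentiable_on k S g"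
  using assms(2,3)
proof (induction k arbitrary: f g)
  case 0
  then show ?case using continuous_on_cong[of S S g f] by fastforce
next
  case (Suc k)
  have D: "frechet_derivative f (at x) = frechet_derivative g (at x)" if "x \<in> S" for x
    using frechet_derivative_transform_within_open[of f x S g] assms(1) Suc.prems that by auto
  have "g differentiable at x" if "x \<in> S" for x
  proof -
    have "f differentiable at x" using Suc.prems(2) that by simp
    then obtain D where "(f has_derivative D) (at x)"
      unfolding differentiable_def by (rule exE)
    from has_derivative_transform_within_open[OF this assms(1) that Suc.prems(1)]
    show ?thesis by (rule differentiableI)
  qed
  moreover have "times_differentiable_on k S (\<lambda>x. frechet_derivative g (at x) v)" for v
    by (rule Suc.IH[of "\<lambda>x. frechet_derivative f (at x) v"]) (use D Suc.prems in auto)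
  ultimately show ?case by simp
qed

lemma times_differentiable_on_Suc_D:
  "times_differentiable_on (Suc k) S f \<Longrightarrow> times_differentiable_on k S f"
proof (induction k arbitrary: f)
  case 0
  then show ?case
    by (simp add: continuous_at_imp_continuous_on differentiable_imp_continuous_within)
next
  case (Suc k)
  note prems = Suc.prems[unfolded times_differentiable_on.simps(2)[of "Suc k"]]
  show ?case
    unfolding times_differentiable_on.simps(2)
    using prems[THEN conjunct1] prems[THEN conjunct2, THEN spec, THEN Suc.IH]
    by (rule conjI[OF _ allI])
qed

text \<open>Accepts a derivative in whatever form a differentiation rule delivers it, so the closure
  proofs never have to compute \<open>frechet_derivative\<close> of a compound function.\<close>

lemma times_differentiable_on_SucI:
  assumes "open S"
    and "\<And>x. x \<in> S \<Longrightarrow> (f has_derivative D x) (at x)"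
    and "\<And>v. times_differentiable_on k S (\<lambda>x. D x v)"
  shows "times_differentiable_on (Suc k) S f"
proof -
  have "times_differentiable_on k S (\<lambda>x. frechet_derivative f (at x) v)" for v
    by (rule times_differentiable_on_cong[OF assms(1) _ assms(3)])
      (simp flip: frechet_derivative_at[OF assms(2)])
  then show ?thesis using assms(2) by (auto simp: differentiable_def)
qed

lemma times_differentiable_on_has_derivative:
  assumes "times_differentiable_on (Suc k) S f" "x \<in> S"
  shows "(f has_derivative frechet_derivative f (at x)) (at x)"
  using assms by (simp add: frechet_derivative_works)

lemma times_differentiable_on_derivative:
  "times_differentiable_on (Suc k) S f
    \<Longrightarrow> times_differentiable_on k S (\<lambda>x. frechet_derivative f (at x) v)"
  unfolding times_differentiable_on.simps(2) by (erule conjE) (erule spec)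

declare times_differentiable_on.simps(2) [simp del]

lemma times_differentiable_on_const [simp]: "times_differentiable_on k S (\<lambda>x. c)"
proof (induction k arbitrary: c)
  case (Suc k)
  then show ?case by (simp add: times_differentiable_on.simps(2))
qed simp

lemma times_differentiable_on_add:
  assumes "open S"
  shows "times_differentiable_on k S f \<Longrightarrow> times_differentiable_on k S g
    \<Longrightarrow> times_differentiable_on k S (\<lambda>x. f x + g x)"
proof (induction k arbitrary: f g)
  case 0
  then show ?case by (auto intro: continuous_on_add)
next
  case (Suc k)
  show ?case
    by (rule times_differentiable_on_SucI[OF assms has_derivative_add,
          OF times_differentiable_on_has_derivative times_differentiable_on_has_derivative])
      (rule Suc.prems Suc.IH times_differentiable_on_derivative | assumption)+
qed

lemma (in bounded_linear) times_differentiable_on: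
  assumes "open S"
  shows "times_differentiable_on k S g \<Longrightarrow> times_differentiable_on k S (\<lambda>x. f (g x))"
proof (induction k arbitrary: g)
  case 0
  then show ?case by (auto intro: continuous_on)
next
  case (Suc k)
  show ?case
    by (rule times_differentiable_on_SucI[OF assms has_derivative,
          OF times_differentiable_on_has_derivative])
      (rule Suc.prems Suc.IH times_differentiable_on_derivative | assumption)+
qed

lemma (in bounded_bilinear) times_differentiable_on:
  assumes "open S"
  shows "times_differentiable_on k S f \<Longrightarrow> times_differentiable_on k S g
    \<Longrightarrow> times_differentiable_on k S (\<lambda>x. prod (f x) (g x))"
proof (induction k arbitrary: f g)
  case 0
  then show ?case by (auto intro: continuous_on)
next
  case (Suc k)
  \<comment> \<open>The product rule mixes derivatives with undifferentiated factors, so the factors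
    are needed at the lower order as well.\<close>
  note lower = Suc.prems[THEN times_differentiable_on_Suc_D]
  show ?case
    by (rule times_differentiable_on_SucI[OF assms FDERIV,
          OF times_differentiable_on_has_derivative times_differentiable_on_has_derivative])
      (rule Suc.prems lower assms times_differentiable_on_add Suc.IH
        times_differentiable_on_derivative | assumption)+
qed

lemma times_differentiable_on_sum:
  assumes "open S" "\<And>i. i \<in> I \<Longrightarrow> times_differentiable_on k S (f i)"
  shows "times_differentiable_on k S (\<lambda>x. \<Sum>i\<in>I. f i x)"
  using assms(2)
  by (induction I rule: infinite_finite_induct) (auto intro: times_differentiable_on_add assms(1))

text \<open>The derivative of the reciprocal contains the reciprocal of the same f again, so the
  induction runs on k with f fixed.\<close>

lemma times_differentiable_on_inverse:
  fixes f :: "'a::real_normed_vector \<Rightarrow> real"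
  assumes "open S" "\<And>x. x \<in> S \<Longrightarrow> f x \<noteq> 0"
  shows "times_differentiable_on k S f \<Longrightarrow> times_differentiable_on k S (\<lambda>x. inverse (f x))"
proof (induction k)
  case 0
  then show ?case using assms by (auto intro!: continuous_on_inverse)
next
  case (Suc k)
  have inv: "times_differentiable_on k S (\<lambda>x. inverse (f x))"
    using Suc times_differentiable_on_Suc_D by blast
  show ?case
  proof (rule times_differentiable_on_SucI[OF assms(1)])
    show "((\<lambda>x. inverse (f x)) has_derivative
        (\<lambda>h. - (inverse (f x) * frechet_derivative f (at x) h * inverse (f x)))) (at x)"
      if "x \<in> S" for x
      using Deriv.has_derivative_inverse[OF assms(2)[OF that]
          times_differentiable_on_has_derivative[OF Suc.prems that]] .
    have "times_differentiable_on k S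
        (\<lambda>x. (inverse (f x) * frechet_derivative f (at x) v) * inverse (f x))" for v
      by (intro bounded_bilinear.times_differentiable_on[OF bounded_bilinear_mult] assms(1) inv
          times_differentiable_on_derivative[OF Suc.prems])
    then show "times_differentiable_on k S
        (\<lambda>x. - (inverse (f x) * frechet_derivative f (at x) v * inverse (f x)))" for v
      by (intro bounded_linear.times_differentiable_on[OF bounded_linear_minus[OF bounded_linear_ident]]
          assms(1))
  qed
qed

lemma linear_expand_axis:
  assumes "linear L"
  shows "L v = (\<Sum>b\<in>UNIV. v $ b *\<^sub>R L (axis b 1))"
proof -
  have "L v = L (\<Sum>b\<in>UNIV. v $ b *\<^sub>R axis b 1)"
    using basis_expansion[of v] by (simp add: scalar_mult_eq_scaleR)
  then show ?thesis by (simp add: linear_sum[OF assms] linear_cmul[OF assms])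
qed

text \<open>Higher differentiability is stated through derivatives in fixed directions, whereas the
  chain rule differentiates g in the moving direction Df(v). Expanding that direction in the
  standard basis leaves fixed directions with differentiable coefficients.\<close>

lemma times_differentiable_on_compose:
  fixes f :: "'a::real_normed_vector \<Rightarrow> real ^ 'n::finite"
  assumes "open S" "open T" "f ` S \<subseteq> T"
  shows "times_differentiable_on k S f \<Longrightarrow> times_differentiable_on k T g
    \<Longrightarrow> times_differentiable_on k S (\<lambda>x. g (f x))"
proof (induction k arbitrary: g)
  case 0
  then show ?case using assms continuous_on_compose2[of T g S f] by auto
next
  case (Suc k)
  let ?D = "\<lambda>x v. \<Sum>b\<in>UNIV. frechet_derivative f (at x) v $ b *\<^sub>R
      frechet_derivative g (at (f x)) (axis b 1)"
  have "((\<lambda>x. g (f x)) has_derivative ?D x) (at x)" if x: "x \<in> S" for x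
  proof -
    have "f x \<in> T" using x assms(3) by blast
    then have g: "g differentiable at (f x)"
      using Suc.prems(2) unfolding times_differentiable_on.simps(2) by simp
    have "((\<lambda>x. g (f x)) has_derivative
        (\<lambda>v. frechet_derivative g (at (f x)) (frechet_derivative f (at x) v))) (at x)"
      using diff_chain_at[OF times_differentiable_on_has_derivative[OF Suc.prems(1) x]
          g[unfolded frechet_derivative_works]]
      by (simp only: o_def)
    then show ?thesis
      by (simp only: linear_expand_axis[OF linear_frechet_derivative[OF g],
            of "frechet_derivative f (at x) v" for v])
  qed
  moreover have "times_differentiable_on k S (\<lambda>x. ?D x v)" for v
  proof (intro times_differentiable_on_sum assms(1)
      bounded_bilinear.times_differentiable_on[OF bounded_bilinear_scaleR]
      bounded_linear.times_differentiable_on[OF bounded_linear_vec_nth])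
    show "times_differentiable_on k S (\<lambda>x. frechet_derivative f (at x) v)"
      using Suc.prems(1) by (rule times_differentiable_on_derivative)
    show "times_differentiable_on k S (\<lambda>x. frechet_derivative g (at (f x)) (axis b 1))" for b
      by (rule Suc.IH[OF times_differentiable_on_Suc_D[OF Suc.prems(1)]
            times_differentiable_on_derivative[OF Suc.prems(2)]])
  qed
  ultimately show ?case by (rule times_differentiable_on_SucI[OF assms(1), where D = ?D])
qed

lemma smooth_on_cong:
  "open S \<Longrightarrow> (\<And>x. x \<in> S \<Longrightarrow> f x = g x) \<Longrightarrow> smooth_on S f \<Longrightarrow> smooth_on S g"
  unfolding smooth_on_def using times_differentiable_on_cong[of S f g] by blast

lemma smooth_on_const [simp]: "smooth_on S (\<lambda>x. c)"
  by (simp add: smooth_on_def)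

lemma smooth_on_add:
  "open S \<Longrightarrow> smooth_on S f \<Longrightarrow> smooth_on S g \<Longrightarrow> smooth_on S (\<lambda>x. f x + g x)"
  by (simp add: smooth_on_def times_differentiable_on_add)

lemma smooth_on_sum:
  "open S \<Longrightarrow> (\<And>i. i \<in> I \<Longrightarrow> smooth_on S (f i)) \<Longrightarrow> smooth_on S (\<lambda>x. \<Sum>i\<in>I. f i x)"
  by (simp add: smooth_on_def times_differentiable_on_sum)

lemma smooth_on_bounded_linear:
  "bounded_linear L \<Longrightarrow> open S \<Longrightarrow> smooth_on S f \<Longrightarrow> smooth_on S (\<lambda>x. L (f x))"
  by (simp add: smooth_on_def bounded_linear.times_differentiable_on)

lemma smooth_on_bounded_bilinear:
  "bounded_bilinear B \<Longrightarrow> open S \<Longrightarrow> smooth_on S f \<Longrightarrow> smooth_on S g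
    \<Longrightarrow> smooth_on S (\<lambda>x. B (f x) (g x))"
  by (simp add: smooth_on_def bounded_bilinear.times_differentiable_on)

lemmas smooth_on_scaleR = smooth_on_bounded_bilinear[OF bounded_bilinear_scaleR]
lemmas smooth_on_mult = smooth_on_bounded_bilinear[OF bounded_bilinear_mult]
lemmas smooth_on_inner = smooth_on_bounded_bilinear[OF bounded_bilinear_inner]
lemmas smooth_on_vec_nth = smooth_on_bounded_linear[OF bounded_linear_vec_nth]

lemma smooth_on_diff:
  assumes "open S" "smooth_on S f" "smooth_on S g"
  shows "smooth_on S (\<lambda>x. f x - g x)"
  using smooth_on_add[OF assms(1,2)
      smooth_on_bounded_linear[OF bounded_linear_minus[OF bounded_linear_ident] assms(1,3)]]
  by simp

lemma smooth_on_divide: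
  fixes f g :: "'a::real_normed_vector \<Rightarrow> real"
  assumes "open S" "smooth_on S f" "smooth_on S g" "\<And>x. x \<in> S \<Longrightarrow> g x \<noteq> 0"
  shows "smooth_on S (\<lambda>x. f x / g x)"
  using smooth_on_mult[OF assms(1,2), of "\<lambda>x. inverse (g x)"] assms
  by (simp add: smooth_on_def times_differentiable_on_inverse divide_inverse)

lemma smooth_on_prod:
  fixes f :: "'i \<Rightarrow> 'a::real_normed_vector \<Rightarrow> real"
  assumes "open S" "\<And>i. i \<in> I \<Longrightarrow> smooth_on S (f i)"
  shows "smooth_on S (\<lambda>x. \<Prod>i\<in>I. f i x)"
  using assms(2)
  by (induction I rule: infinite_finite_induct) (auto intro: smooth_on_mult assms(1))

lemma smooth_on_compose:
  fixes f :: "'a::real_normed_vector \<Rightarrow> real ^ 'n::finite"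
  assumes "open S" "open T" "f ` S \<subseteq> T" "smooth_on S f" "smooth_on T g"
  shows "smooth_on S (\<lambda>x. g (f x))"
  using assms by (simp add: smooth_on_def times_differentiable_on_compose)

lemma smooth_on_subset:
  assumes "smooth_on S f" "T \<subseteq> S"
  shows "smooth_on T f"
proof -
  have "times_differentiable_on k S f \<Longrightarrow> times_differentiable_on k T f" for k
  proof (induction k arbitrary: f)
    case 0
    then show ?case using continuous_on_subset[OF _ assms(2)] by simp
  next
    case (Suc k)
    have "times_differentiable_on k T (\<lambda>x. frechet_derivative f (at x) v)" for v
      by (rule Suc.IH[OF times_differentiable_on_derivative[OF Suc.prems]])
    moreover have "f differentiable at x" if "x \<in> T" for x
      using times_differentiable_on_has_derivative[OF Suc.prems] assms(2) that
      by (auto intro: differentiableI)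
    ultimately show ?case by (simp add: times_differentiable_on.simps(2))
  qed
  then show ?thesis using assms(1) by (simp add: smooth_on_def)
qed

lemma bounded_linear_axis: "bounded_linear (axis i :: 'b::real_normed_vector \<Rightarrow> 'b ^ 'n::finite)"
proof (rule bounded_linear_intro[where K = 1])
  fix r :: 'b
  have "norm (axis i r :: 'b ^ 'n) \<le> (\<Sum>j\<in>UNIV. norm ((axis i r :: 'b ^ 'n) $ j))"
    unfolding norm_vec_def by (rule L2_set_le_sum) simp
  also have "\<dots> = norm r"
    by (simp add: axis_def if_distrib[of norm] cong: if_cong)
  finally show "norm (axis i r :: 'b ^ 'n) \<le> norm r * 1" by simp
qed (auto simp: axis_def vec_eq_iff)

lemma smooth_on_vec_lambda:
  fixes f :: "'a::real_normed_vector \<Rightarrow> 'n::finite \<Rightarrow> 'b::real_normed_vector"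
  assumes "open S" "\<And>i. smooth_on S (\<lambda>x. f x i)"
  shows "smooth_on S (\<lambda>x. \<chi> i. f x i)"
proof -
  have "(\<chi> i. f x i) = (\<Sum>i\<in>UNIV. axis i (f x i))" for x
    by (simp add: vec_eq_iff axis_def)
  then show ?thesis
    using assms by (auto intro!: smooth_on_sum smooth_on_bounded_linear[OF bounded_linear_axis])
qed

lemma smooth_on_imp_differentiable: "smooth_on S f \<Longrightarrow> x \<in> S \<Longrightarrow> f differentiable at x"
  unfolding smooth_on_def by (auto simp: times_differentiable_on.simps(2) dest: spec[of _ "Suc 0"])

lemma smooth_on_imp_continuous_on: "smooth_on S f \<Longrightarrow> continuous_on S f"
  unfolding smooth_on_def by (auto dest: spec[of _ 0])

lemma smooth_on_frechet_derivative:
  "smooth_on S f \<Longrightarrow> smooth_on S (\<lambda>x. frechet_derivative f (at x) v)"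
  unfolding smooth_on_def by (simp add: times_differentiable_on_derivative)

lemma smooth_on_partial: "smooth_on S f \<Longrightarrow> smooth_on S (partial i f)"
  unfolding partial_def[abs_def] by (rule smooth_on_frechet_derivative)

lemma smooth_on_det:
  fixes A :: "'a::real_normed_vector \<Rightarrow> real ^ 'n ^ 'n::finite"
  assumes "open S" "\<And>i j. smooth_on S (\<lambda>x. A x $ i $ j)"
  shows "smooth_on S (\<lambda>x. det (A x))"
  unfolding det_def using assms
  by (auto intro!: smooth_on_sum smooth_on_mult smooth_on_prod)

section \<open>Smooth dependence of the inverse matrix\<close>

lemma matrix_inv_right: "invertible A \<Longrightarrow> A ** matrix_inv A = mat 1"
  and matrix_inv_left: "invertible A \<Longrightarrow> matrix_inv A ** A = mat 1"
  unfolding invertible_def matrix_inv_def by (metis (mono_tags, lifting) someI_ex)+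

text \<open>Column l of the inverse solves A z = \<open>axis l 1\<close>. Cramer's rule then
  exhibits the entries as quotients of polynomials in the entries of A, which makes them
  smooth.\<close>

lemma matrix_inv_cramer:
  fixes A :: "real ^ 'n ^ 'n"
  assumes "invertible A"
  shows "matrix_inv A $ k $ l
    = det (\<chi> i j. if j = k then axis l 1 $ i else A $ i $ j) / det A"
proof -
  have d: "det A \<noteq> 0" using assms by (simp add: invertible_det_nz)
  have "A *v (matrix_inv A *v axis l 1) = axis l 1"
    by (simp add: matrix_vector_mul_assoc matrix_inv_right[OF assms])
  with cramer[OF d, of "matrix_inv A *v axis l 1" "axis l 1"]
  have "matrix_inv A *v axis l 1
      = (\<chi> k. det (\<chi> i j. if j = k then axis l 1 $ i else A $ i $ j) / det A)"
    by (rule iffD1)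
  from arg_cong[OF this, of "\<lambda>v. v $ k"]
  have "(matrix_inv A *v axis l 1) $ k
      = det (\<chi> i j. if j = k then axis l 1 $ i else A $ i $ j) / det A"
    by (simp only: vec_lambda_beta)
  then show ?thesis by (simp only: matrix_vector_mult_basis column_def vec_lambda_beta)
qed

lemma smooth_on_matrix_inv:
  fixes A :: "'a::real_normed_vector \<Rightarrow> real ^ 'n ^ 'n::finite"
  assumes "open S" "smooth_on S A" "\<And>x. x \<in> S \<Longrightarrow> invertible (A x)"
  shows "smooth_on S (\<lambda>x. matrix_inv (A x))"
proof -
  have *: "smooth_on S (\<lambda>x. A x $ i $ j)" for i j
    by (rule smooth_on_vec_nth[OF assms(1) smooth_on_vec_nth[OF assms(1,2)]])
  have entries: "smooth_on S (\<lambda>x. matrix_inv (A x) $ k $ l)" for k l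
  proof -
    define C where "C x = (\<chi> i j. if j = k then axis l 1 $ i else A x $ i $ j)" for x
    have "smooth_on S (\<lambda>x. C x $ i $ j)" for i j
      by (cases "j = k") (simp_all add: C_def *)
    note num = smooth_on_det[OF assms(1) this]
    have nz: "det (A x) \<noteq> 0" if "x \<in> S" for x
      using assms(3)[OF that] by (simp add: invertible_det_nz)
    have eq: "det (C x) / det (A x) = matrix_inv (A x) $ k $ l" if "x \<in> S" for x
      unfolding C_def by (rule matrix_inv_cramer[OF assms(3)[OF that], symmetric])
    from smooth_on_cong[OF assms(1) eq smooth_on_divide[OF assms(1) num smooth_on_det[OF assms(1) *] nz]]
    show ?thesis .
  qed
  have "smooth_on S (\<lambda>x. \<chi> k l. matrix_inv (A x) $ k $ l)"
    by (rule smooth_on_vec_lambda[OF assms(1) smooth_on_vec_lambda[OF assms(1) entries]])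
  then show ?thesis by (simp only: vec_lambda_eta)
qed

subsection \<open>Partial derivatives\<close>

lemma has_derivative_partial:
  assumes "(f has_derivative D) (at x)"
  shows "partial i f x = D (axis i 1)"
  unfolding partial_def frechet_derivative_at[OF assms] ..

text \<open>\<open>frechet_derivative\<close> is a choice among the derivatives at x, and functions
  that agree near x have the same ones; this covers the case where there is none.\<close>

lemma partial_cong:
  assumes "open S" "x \<in> S" "\<And>y. y \<in> S \<Longrightarrow> f y = g y"
  shows "partial i f x = partial i g x"
proof -
  have "(f has_derivative D) (at x) = (g has_derivative D) (at x)" for D
  proof
    assume "(f has_derivative D) (at x)"
    then show "(g has_derivative D) (at x)"
      by (rule has_derivative_transform_within_open[OF _ assms(1,2)]) (rule assms(3))
  next
    assume "(g has_derivative D) (at x)"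
    then show "(f has_derivative D) (at x)"
      by (rule has_derivative_transform_within_open[OF _ assms(1,2)]) (rule assms(3)[symmetric])
  qed
  then have "frechet_derivative f (at x) = frechet_derivative g (at x)"
    unfolding frechet_derivative_def by (simp only:)
  then show ?thesis by (simp only: partial_def)
qed

lemma partial_const [simp]: "partial i (\<lambda>x. c) x = 0"
  by (simp add: partial_def)

lemma partial_add:
  assumes "f differentiable at x" "g differentiable at x"
  shows "partial i (\<lambda>x. f x + g x) x = partial i f x + partial i g x"
  unfolding has_derivative_partial[OF has_derivative_add[OF assms[unfolded frechet_derivative_works]]]
  by (simp only: partial_def)

lemma partial_bounded_linear:
  assumes "bounded_linear L" "f differentiable at x"
  shows "partial i (\<lambda>x. L (f x)) x = L (partial i f x)"
  unfolding has_derivative_partial[OF bounded_linear.has_derivative[OF assms(1)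
        assms(2)[unfolded frechet_derivative_works]]]
  by (simp only: partial_def)

lemma partial_bounded_bilinear:
  assumes "bounded_bilinear B" "f differentiable at x" "g differentiable at x"
  shows "partial i (\<lambda>x. B (f x) (g x)) x = B (f x) (partial i g x) + B (partial i f x) (g x)"
  unfolding has_derivative_partial[OF bounded_bilinear.FDERIV[OF assms(1)
        assms(2,3)[unfolded frechet_derivative_works]]]
  by (simp only: partial_def)

lemma partial_compose:
  fixes f :: "real ^ 'm::finite \<Rightarrow> real ^ 'n::finite"
  assumes "f differentiable at x" "g differentiable at (f x)"
  shows "partial i (\<lambda>x. g (f x)) x = (\<Sum>b\<in>UNIV. partial i f x $ b *\<^sub>R partial b g (f x))"
proof -
  have "partial i (\<lambda>x. g (f x)) x
      = frechet_derivative g (at (f x)) (frechet_derivative f (at x) (axis i 1))"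
    using frechet_derivative_compose[OF assms]
    by (simp add: partial_def o_def)
  also have "\<dots> = (\<Sum>b\<in>UNIV. partial i f x $ b *\<^sub>R partial b g (f x))"
    unfolding partial_def by (rule linear_expand_axis[OF linear_frechet_derivative[OF assms(2)]])
  finally show ?thesis .
qed

lemma partial_vec_nth:
  "f differentiable at x \<Longrightarrow> partial i (\<lambda>x. f x $ a) x = partial i f x $ a"
  by (rule partial_bounded_linear[OF bounded_linear_vec_nth])

subsection \<open>Symmetry of second derivatives\<close>

text \<open>The second difference quotient equals a mixed second derivative at a nearby point; as the
  quotient is symmetric in the two directions, both mixed derivatives have the same limit.\<close>

lemma second_difference_mvt:
  fixes g a b :: "real \<Rightarrow> real \<Rightarrow> real"
  assumes h: "0 < h"
    and a: "\<And>s t. \<lbrakk>0 \<le> s; s \<le> h; 0 \<le> t; t \<le> h\<rbrakk>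
      \<Longrightarrow> ((\<lambda>s. g s t) has_field_derivative a s t) (at s)"
    and b: "\<And>s t. \<lbrakk>0 \<le> s; s \<le> h; 0 \<le> t; t \<le> h\<rbrakk>
      \<Longrightarrow> (a s has_field_derivative b s t) (at t)"
  obtains s t where "0 \<le> s" "s \<le> h" "0 \<le> t" "t \<le> h"
    "g h h - g h 0 - g 0 h + g 0 0 = h * h * b s t"
proof -
  \<comment> \<open>Mean value theorem in s for the increment g(s, h) - g(s, 0), and afterwards in t
    for \<open>a s\<close>.\<close>
  have "\<exists>s>0. s < h \<and> (g h h - g h 0) - (g 0 h - g 0 0) = (h - 0) * (a s h - a s 0)"
    by (rule MVT2[OF h, of "\<lambda>s. g s h - g s 0" "\<lambda>s. a s h - a s 0"])
      (rule DERIV_diff; rule a; use h in simp)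
  then obtain s where s: "0 < s" "s < h" "(g h h - g h 0) - (g 0 h - g 0 0) = h * (a s h - a s 0)"
    by auto
  have "\<exists>t>0. t < h \<and> a s h - a s 0 = (h - 0) * b s t"
    by (rule MVT2[OF h]) (rule b; use s in simp)
  then obtain t where t: "0 < t" "t < h" "a s h - a s 0 = h * b s t"
    by auto
  have "g h h - g h 0 - g 0 h + g 0 0 = h * (h * b s t)"
    using s(3) unfolding t(3) by linarith
  then show ?thesis using that[of s t] s t by (simp only: mult.assoc less_imp_le)
qed

lemma has_field_derivative_along_line:
  fixes f :: "'a::real_normed_vector \<Rightarrow> real"
  assumes "f differentiable at (p + s *\<^sub>R v)"
  shows "((\<lambda>s. f (p + s *\<^sub>R v)) has_field_derivative
    frechet_derivative f (at (p + s *\<^sub>R v)) v) (at s)"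
proof -
  note f = assms[unfolded frechet_derivative_works]
  have "((\<lambda>s. p + s *\<^sub>R v) has_derivative (\<lambda>k. k *\<^sub>R v)) (at s)"
    by (auto intro!: derivative_eq_intros)
  from diff_chain_at[OF this f]
  have "((\<lambda>s. f (p + s *\<^sub>R v)) has_derivative
      (\<lambda>k. frechet_derivative f (at (p + s *\<^sub>R v)) (k *\<^sub>R v))) (at s)"
    by (simp only: o_def)
  then show ?thesis
    unfolding has_field_derivative_def
    by (simp only: linear_cmul[OF linear_frechet_derivative[OF assms]] real_scaleR_def mult_commute_abs)
qed

lemma frechet_derivative_symmetric:
  fixes f :: "'a::real_normed_vector \<Rightarrow> real"
  assumes "open S" "smooth_on S f" "x \<in> S"
  shows "frechet_derivative (\<lambda>y. frechet_derivative f (at y) u) (at x) v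
    = frechet_derivative (\<lambda>y. frechet_derivative f (at y) v) (at x) u"
proof -
  let ?E = "\<lambda>u v y. frechet_derivative (\<lambda>y. frechet_derivative f (at y) u) (at y) v"
  note D = smooth_on_frechet_derivative
  have E: "isCont (?E u v) x" for u v
    using smooth_on_imp_continuous_on[OF D[OF D[OF assms(2)]]] assms(1,3)
    by (simp add: continuous_on_eq_continuous_at)
  have "\<bar>?E u v x - ?E v u x\<bar> < 2 * e" if "0 < e" for e
  proof -
    obtain d1 where d1: "0 < d1" "\<And>y. dist y x < d1 \<Longrightarrow> dist (?E u v y) (?E u v x) < e"
      using E[of u v] \<open>0 < e\<close> unfolding continuous_at_eps_delta by blast
    obtain d2 where d2: "0 < d2" "\<And>y. dist y x < d2 \<Longrightarrow> dist (?E v u y) (?E v u x) < e"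
      using E[of v u] \<open>0 < e\<close> unfolding continuous_at_eps_delta by blast
    obtain d3 where d3: "0 < d3" "ball x d3 \<subseteq> S"
      using assms openE by blast
    define d where "d = Min {d1, d2, d3}"
    have d: "0 < d" "d \<le> d1" "d \<le> d2" "d \<le> d3" using d1 d2 d3 by (auto simp: d_def)
    \<comment> \<open>A step for which every displacement s u + t v with s and t in [0, h] is
      shorter than d. The summand 1 keeps the denominator positive when u and v vanish.\<close>
    define h where "h = d / (2 * (norm u + norm v + 1))"
    have pos: "0 < norm u + norm v + 1" by (simp add: add_nonneg_pos)
    have h: "0 < h" using d pos by (simp add: h_def)
    have hn: "h * norm u + h * norm v < d"
    proof -
      have "h * norm u + h * norm v < h * (2 * (norm u + norm v + 1))"
      proof -
        have "norm u + norm v < 2 * (norm u + norm v + 1)" using pos by simp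
        then have "h * (norm u + norm v) < h * (2 * (norm u + norm v + 1))"
          using h by (rule mult_strict_left_mono)
        then show ?thesis by (simp add: distrib_left)
      qed
      also have "\<dots> = d" using pos by (simp add: h_def)
      finally show ?thesis .
    qed
    have near: "dist (x + s *\<^sub>R u + t *\<^sub>R v) x < d"
      if "0 \<le> s" "s \<le> h" "0 \<le> t" "t \<le> h" for s t
    proof -
      have "dist (x + s *\<^sub>R u + t *\<^sub>R v) x \<le> s * norm u + t * norm v"
        using norm_triangle_ineq[of "s *\<^sub>R u" "t *\<^sub>R v"] that by (simp add: dist_norm add.assoc)
      also have "\<dots> \<le> h * norm u + h * norm v"
        using that by (intro add_mono mult_right_mono) auto
      finally show ?thesis using hn by simp
    qed
    have inS: "x + s *\<^sub>R u + t *\<^sub>R v \<in> S" if "0 \<le> s" "s \<le> h" "0 \<le> t" "t \<le> h" for s t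
      using near[OF that] d d3 by (auto simp: dist_commute subset_iff)
    \<comment> \<open>The directions are left arbitrary so that both orders of differentiation are
      covered.\<close>
    have mvt: "\<exists>s t. 0 \<le> s \<and> s \<le> h \<and> 0 \<le> t \<and> t \<le> h \<and>
        f (x + h *\<^sub>R w + h *\<^sub>R z) - f (x + h *\<^sub>R w) - f (x + h *\<^sub>R z) + f x
          = h * h * ?E w z (x + s *\<^sub>R w + t *\<^sub>R z)"
      if inS: "\<And>s t. \<lbrakk>0 \<le> s; s \<le> h; 0 \<le> t; t \<le> h\<rbrakk> \<Longrightarrow> x + s *\<^sub>R w + t *\<^sub>R z \<in> S" for w z
    proof -
      let ?g = "\<lambda>s t. f (x + s *\<^sub>R w + t *\<^sub>R z)"
      let ?a = "\<lambda>s t. frechet_derivative f (at (x + s *\<^sub>R w + t *\<^sub>R z)) w"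
      let ?b = "\<lambda>s t. ?E w z (x + s *\<^sub>R w + t *\<^sub>R z)"
      have a: "((\<lambda>s. ?g s t) has_field_derivative ?a s t) (at s)"
        if "0 \<le> s" "s \<le> h" "0 \<le> t" "t \<le> h" for s t
        using has_field_derivative_along_line[of f "x + t *\<^sub>R z" s w]
          smooth_on_imp_differentiable[OF assms(2) inS[OF that]]
        by (simp only: add.assoc add.commute[of "t *\<^sub>R z"])
      have b: "(?a s has_field_derivative ?b s t) (at t)"
        if "0 \<le> s" "s \<le> h" "0 \<le> t" "t \<le> h" for s t
        by (rule has_field_derivative_along_line[OF
              smooth_on_imp_differentiable[OF D[OF assms(2)] inS[OF that]]])
      obtain s t where "0 \<le> s" "s \<le> h" "0 \<le> t" "t \<le> h"
        "?g h h - ?g h 0 - ?g 0 h + ?g 0 0 = h * h * ?b s t"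
        by (rule second_difference_mvt[OF h a b])
      then show ?thesis
        by (intro exI[of _ s] exI[of _ t] conjI) (simp_all only: scaleR_zero_left add_0_right)
    qed
    have inS': "x + s *\<^sub>R v + t *\<^sub>R u \<in> S" if "0 \<le> s" "s \<le> h" "0 \<le> t" "t \<le> h" for s t
      using inS[OF that(3,4,1,2)] by (simp add: ac_simps)
    obtain s t where st: "0 \<le> s" "s \<le> h" "0 \<le> t" "t \<le> h"
      "f (x + h *\<^sub>R u + h *\<^sub>R v) - f (x + h *\<^sub>R u) - f (x + h *\<^sub>R v) + f x
        = h * h * ?E u v (x + s *\<^sub>R u + t *\<^sub>R v)"
      using mvt[OF inS] by blast
    obtain s' t' where st': "0 \<le> s'" "s' \<le> h" "0 \<le> t'" "t' \<le> h"
      "f (x + h *\<^sub>R v + h *\<^sub>R u) - f (x + h *\<^sub>R v) - f (x + h *\<^sub>R u) + f x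
        = h * h * ?E v u (x + s' *\<^sub>R v + t' *\<^sub>R u)"
      using mvt[OF inS'] by blast
    have "h * h * ?E u v (x + s *\<^sub>R u + t *\<^sub>R v) = h * h * ?E v u (x + s' *\<^sub>R v + t' *\<^sub>R u)"
      using st(5) st'(5) by (simp add: algebra_simps)
    then have "?E u v (x + s *\<^sub>R u + t *\<^sub>R v) = ?E v u (x + s' *\<^sub>R v + t' *\<^sub>R u)" using h by simp
    moreover have "dist (?E u v (x + s *\<^sub>R u + t *\<^sub>R v)) (?E u v x) < e"
      using near[OF st(1-4)] d by (intro d1(2)) simp
    moreover have "dist (?E v u (x + s' *\<^sub>R v + t' *\<^sub>R u)) (?E v u x) < e"
      using near[OF st'(3,4,1,2)] d by (intro d2(2)) (simp add: ac_simps)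
    ultimately show ?thesis by (simp add: dist_real_def)
  qed
  \<comment> \<open>With e half of the gap, the estimate would make a positive gap smaller than
    itself.\<close>
  from this[of "\<bar>?E u v x - ?E v u x\<bar> / 2"] have "\<not> 0 < \<bar>?E u v x - ?E v u x\<bar>" by auto
  then show ?thesis by (simp only: zero_less_abs_iff diff_eq_eq eq_iff_diff_eq_0[symmetric] not_not)
qed

lemma partial_commute:
  fixes f :: "real ^ 'm::finite \<Rightarrow> real"
  assumes "open S" "smooth_on S f" "x \<in> S"
  shows "partial i (partial j f) x = partial j (partial i f) x"
  using frechet_derivative_symmetric[OF assms] unfolding partial_def[abs_def] by blast

lemma partial_commute_vec:
  fixes f :: "real ^ 'm::finite \<Rightarrow> real ^ 'n::finite"
  assumes "open S" "smooth_on S f" "x \<in> S"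
  shows "partial i (partial j f) x = partial j (partial i f) x"
proof -
  have *: "partial i (partial j f) x $ a = partial i (partial j (\<lambda>y. f y $ a)) x" for i j a
  proof -
    have "partial i (partial j f) x $ a = partial i (\<lambda>y. partial j f y $ a) x"
      using smooth_on_imp_differentiable[OF smooth_on_partial[OF assms(2)] assms(3)]
      by (simp add: partial_vec_nth)
    also have "\<dots> = partial i (partial j (\<lambda>y. f y $ a)) x"
      by (rule partial_cong[OF assms(1,3)])
        (simp add: partial_vec_nth smooth_on_imp_differentiable[OF assms(2)])
    finally show ?thesis .
  qed
  show ?thesis
    by (simp add: vec_eq_iff * partial_commute[OF assms(1) smooth_on_vec_nth[OF assms(1,2)] assms(3)])
qed

subsection \<open>The Levi-Civita connection and its curvature\<close>

text \<open>The matrix of the endomorphism \<open>V \<mapsto> \<nabla>\<^bsub>\<partial>\<^sub>b\<^esub> V\<close> in the coordinate frame.\<close>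

definition connection_matrix ::
    "(real ^ 'n \<Rightarrow> real ^ 'n ^ 'n) \<Rightarrow> 'n::finite \<Rightarrow> real ^ 'n \<Rightarrow> real ^ 'n ^ 'n" where
  "connection_matrix H b y = (\<chi> a c. christoffel H y a b c)"

text \<open>The endomorphism w \<mapsto> R(\<partial>_i, \<partial>_j) w in the coordinate frame. As
  a matrix it can be written with products of connection matrices.\<close>

definition curvature_matrix ::
    "(real ^ 'n \<Rightarrow> real ^ 'n ^ 'n) \<Rightarrow> 'n::finite \<Rightarrow> 'n \<Rightarrow> real ^ 'n \<Rightarrow> real ^ 'n ^ 'n" where
  "curvature_matrix H i j y = (\<chi> l k. riem H y l k i j)"

lemma bounded_bilinear_matrix_mult:
  "bounded_bilinear ((**) :: real ^ 'n ^ 'm \<Rightarrow> real ^ 'k ^ 'n \<Rightarrow> real ^ 'k ^ 'm)"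
  unfolding bilinear_conv_bounded_bilinear[symmetric] bilinear_def
  by (auto intro!: linearI simp: vec_eq_iff matrix_matrix_mult_def sum.distrib sum_distrib_left
      distrib_left distrib_right mult_ac)

lemma bounded_bilinear_matrix_vector_mult:
  "bounded_bilinear ((*v) :: real ^ 'n ^ 'm \<Rightarrow> real ^ 'n \<Rightarrow> real ^ 'm)"
  unfolding bilinear_conv_bounded_bilinear[symmetric] bilinear_def
  by (auto intro!: linearI simp: matrix_vector_mult_add_rdistrib matrix_vector_right_distrib
      scaleR_matrix_vector_assoc matrix_vector_mult_scaleR)

lemma bounded_linear_transpose:
  "bounded_linear (transpose :: real ^ 'n ^ 'm \<Rightarrow> real ^ 'm ^ 'n)"
  unfolding linear_conv_bounded_linear[symmetric]
  by (rule linearI) (simp_all add: transpose_def vec_eq_iff)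

lemma positive_definite_invertible:
  fixes A :: "real ^ 'n ^ 'n"
  assumes "\<And>v. v \<noteq> 0 \<Longrightarrow> 0 < v \<bullet> (A *v v)"
  shows "invertible A"
proof -
  have "v = 0" if "A *v v = 0" for v
    using assms[of v] that by force
  then have "\<exists>B. B ** A = mat 1"
    unfolding matrix_left_invertible_ker by blast
  then show ?thesis by (simp add: invertible_left_inverse)
qed

lemma inner_symmetric_matrix:
  fixes A :: "real ^ 'n ^ 'n"
  assumes "transpose A = A"
  shows "v \<bullet> (A *v w) = w \<bullet> (A *v v)"
proof -
  have "v \<bullet> (A *v w) = (v v* A) \<bullet> w"
    by (rule dot_lmul_matrix[symmetric])
  also have "v v* A = A *v v"
    using transpose_matrix_vector[of A v] assms by simp
  finally show ?thesis by (simp only: inner_commute)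
qed

lemma inner_transpose_matrix:
  fixes A :: "real ^ 'n ^ 'm"
  shows "v \<bullet> (transpose A *v w) = w \<bullet> (A *v v)"
  by (simp only: transpose_matrix_vector inner_commute[of v] dot_lmul_matrix)

lemma differentiable_bounded_linear:
  assumes "bounded_linear L" "f differentiable F"
  shows "(\<lambda>x. L (f x)) differentiable F"
  by (rule differentiableI[OF bounded_linear.has_derivative[OF assms(1)
        assms(2)[unfolded frechet_derivative_works]]])

lemma differentiable_bounded_bilinear:
  assumes "bounded_bilinear B" "f differentiable at x" "g differentiable at x"
  shows "(\<lambda>x. B (f x) (g x)) differentiable at x"
  by (rule differentiableI[OF bounded_bilinear.FDERIV[OF assms(1)
        assms(2,3)[unfolded frechet_derivative_works]]])

lemma partial_matrix_nth:
  assumes "A differentiable at x"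
  shows "partial i (\<lambda>y. A y $ a $ b) x = partial i A x $ a $ b"
proof -
  have "(\<lambda>y. A y $ a) differentiable at x"
    by (rule differentiable_bounded_linear[OF bounded_linear_vec_nth assms])
  then show ?thesis by (simp add: partial_vec_nth assms)
qed

locale local_metric =
  fixes W :: "(real ^ 'n::finite) set" and H :: "real ^ 'n \<Rightarrow> real ^ 'n ^ 'n"
  assumes open_dom: "open W"
    and smooth_metric: "smooth_on W H"
    and metric_sym: "y \<in> W \<Longrightarrow> transpose (H y) = H y"
    and metric_pos: "\<lbrakk>y \<in> W; v \<noteq> 0\<rbrakk> \<Longrightarrow> 0 < v \<bullet> (H y *v v)"
begin

lemma metric_invertible: "y \<in> W \<Longrightarrow> invertible (H y)"
  by (rule positive_definite_invertible) (rule metric_pos)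

lemma metric_nth_commute: "y \<in> W \<Longrightarrow> H y $ i $ j = H y $ j $ i"
  by (subst metric_sym[symmetric], assumption) (simp only: transpose_def vec_lambda_beta)

lemma metric_differentiable: "y \<in> W \<Longrightarrow> H differentiable at y"
  using smooth_metric by (rule smooth_on_imp_differentiable)

lemma partial_metric_nth_commute:
  assumes "y \<in> W"
  shows "partial b (\<lambda>y. H y $ i $ j) y = partial b (\<lambda>y. H y $ j $ i) y"
  by (rule partial_cong[OF open_dom assms]) (rule metric_nth_commute)

lemma christoffel_commute:
  assumes "y \<in> W"
  shows "christoffel H y k i j = christoffel H y k j i"
  unfolding christoffel_def partial_metric_nth_commute[OF assms, of _ i j]
  by (simp add: algebra_simps)

text \<open>Multiplication by the metric cancels the inverse in the definition; what remains are the
  Christoffel symbols of the first kind.\<close>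

lemma lower_christoffel:
  assumes "y \<in> W"
  shows "(\<Sum>k\<in>UNIV. H y $ l $ k * christoffel H y k i j)
    = (partial i (\<lambda>y. H y $ j $ l) y + partial j (\<lambda>y. H y $ i $ l) y
        - partial l (\<lambda>y. H y $ i $ j) y) / 2"
proof -
  define q :: "real ^ 'n" where "q = (\<chi> l. (partial i (\<lambda>y. H y $ j $ l) y
      + partial j (\<lambda>y. H y $ i $ l) y - partial l (\<lambda>y. H y $ i $ j) y) / 2)"
  have "(\<chi> k. christoffel H y k i j) = matrix_inv (H y) *v q"
    unfolding christoffel_def q_def matrix_vector_mult_def
    by (simp add: sum_distrib_left mult.commute)
  then have "H y *v (\<chi> k. christoffel H y k i j) = q"
    using matrix_inv_right[OF metric_invertible[OF assms]]
    by (simp add: matrix_vector_mul_assoc)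
  from arg_cong[OF this, of "\<lambda>v. v $ l"] show ?thesis
    by (simp add: matrix_vector_mult_def q_def)
qed

text \<open>Metric compatibility of the Levi-Civita connection. In the sum of a lowered symbol and
  its transpose, the derivatives in the two other directions cancel.\<close>

lemma partial_metric:
  assumes "y \<in> W"
  shows "partial b H y = H y ** connection_matrix H b y
    + transpose (H y ** connection_matrix H b y)"
proof -
  have Q: "(H y ** connection_matrix H b y) $ j $ k
      = (partial b (\<lambda>y. H y $ k $ j) y + partial k (\<lambda>y. H y $ b $ j) y
        - partial j (\<lambda>y. H y $ b $ k) y) / 2" for j k
    using lower_christoffel[OF assms, of j b k]
    by (simp add: matrix_matrix_mult_def connection_matrix_def)
  have "partial b H y $ j $ k = (H y ** connection_matrix H b y) $ j $ k
      + (H y ** connection_matrix H b y) $ k $ j" for j k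
    unfolding Q partial_metric_nth_commute[OF assms, of b k j]
    using partial_matrix_nth[OF metric_differentiable[OF assms], of b j k] by (simp add: field_simps)
  then show ?thesis by (simp add: vec_eq_iff transpose_def)
qed

lemma smooth_christoffel: "smooth_on W (\<lambda>y. christoffel H y k i j)"
proof -
  have H: "smooth_on W (\<lambda>y. H y $ i $ j)" for i j
    by (rule smooth_on_vec_nth[OF open_dom smooth_on_vec_nth[OF open_dom smooth_metric]])
  have d: "smooth_on W (\<lambda>x. partial b (\<lambda>y. H y $ i $ j) x)" for b i j
    by (rule smooth_on_partial[OF H])
  have "smooth_on W (\<lambda>y. matrix_inv (H y))"
    by (rule smooth_on_matrix_inv[OF open_dom smooth_metric metric_invertible])
  then have inv: "smooth_on W (\<lambda>y. matrix_inv (H y) $ k $ l)" for l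
    by (rule smooth_on_vec_nth[OF open_dom smooth_on_vec_nth[OF open_dom]])
  show ?thesis
    unfolding christoffel_def
    by (rule smooth_on_mult[OF open_dom smooth_on_const smooth_on_sum[OF open_dom
            smooth_on_mult[OF open_dom inv smooth_on_diff[OF open_dom smooth_on_add[OF open_dom d d] d]]]])
qed

lemma smooth_connection_matrix: "smooth_on W (connection_matrix H b)"
  using smooth_on_vec_lambda[OF open_dom smooth_on_vec_lambda[OF open_dom smooth_christoffel]]
  unfolding connection_matrix_def[abs_def] .

text \<open>The sums over s in \<open>riem\<close> are entries of matrix products, so the curvature
  becomes the usual curvature of a connection form, with a commutator as its quadratic part.\<close>

lemma curvature_matrix_eq:
  assumes "y \<in> W"
  shows "curvature_matrix H i j y
    = partial i (connection_matrix H j) y - partial j (connection_matrix H i) y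
      + connection_matrix H i y ** connection_matrix H j y
      - connection_matrix H j y ** connection_matrix H i y"
proof -
  have "partial i (\<lambda>y. christoffel H y l j k) y = partial i (connection_matrix H j) y $ l $ k"
    for i j k l
    using partial_matrix_nth[OF smooth_on_imp_differentiable[OF smooth_connection_matrix assms],
        of i j l k]
    by (simp add: connection_matrix_def)
  then show ?thesis
    by (simp add: vec_eq_iff curvature_matrix_def riem_def matrix_matrix_mult_def sum_subtractf)
      (simp add: connection_matrix_def)
qed

text \<open>Compare the two mixed second derivatives of the metric, expressed through
  \<open>partial_metric\<close>.\<close>

lemma curvature_matrix_antisymmetric:
  assumes "y \<in> W"
  shows "transpose (H y ** curvature_matrix H i j y) = - (H y ** curvature_matrix H i j y)"
proof -
  let ?C = "\<lambda>b. connection_matrix H b y"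
  let ?Q = "\<lambda>b y. H y ** connection_matrix H b y"
  have diffC: "connection_matrix H b differentiable at y" for b
    by (rule smooth_on_imp_differentiable[OF smooth_connection_matrix assms])
  have diffQ: "(\<lambda>y. ?Q b y) differentiable at y" for b
    by (rule smooth_on_imp_differentiable[OF smooth_on_bounded_bilinear[OF
            bounded_bilinear_matrix_mult open_dom smooth_metric smooth_connection_matrix] assms])
  have diffQT: "(\<lambda>y. transpose (?Q b y)) differentiable at y" for b
    by (rule differentiable_bounded_linear[OF bounded_linear_transpose diffQ])
  have PQ: "partial a (?Q b) y = H y ** partial a (connection_matrix H b) y
      + (H y ** ?C a ** ?C b + transpose (H y ** ?C a) ** ?C b)" for a b
    using partial_bounded_bilinear[OF bounded_bilinear_matrix_mult metric_differentiable[OF assms] diffC]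
    by (simp only: partial_metric[OF assms] bounded_bilinear.add_left[OF bounded_bilinear_matrix_mult])
  have second: "partial a (partial b H) y = partial a (?Q b) y + transpose (partial a (?Q b) y)"
    for a b
  proof -
    have "partial a (partial b H) y = partial a (\<lambda>y. ?Q b y + transpose (?Q b y)) y"
      by (rule partial_cong[OF open_dom assms partial_metric])
    then show ?thesis
      by (simp add: partial_add[OF diffQ diffQT] partial_bounded_linear[OF bounded_linear_transpose diffQ])
  qed
  have comm: "partial i (partial j H) y = partial j (partial i H) y"
  proof -
    have "partial a (partial b H) y $ k $ l = partial a (partial b (\<lambda>y. H y $ k $ l)) y" for a b k l
    proof -
      have "partial a (partial b (\<lambda>y. H y $ k $ l)) y = partial a (\<lambda>y. partial b H y $ k $ l) y"
        by (rule partial_cong[OF open_dom assms partial_matrix_nth[OF metric_differentiable]])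
      then show ?thesis
        using partial_matrix_nth[OF smooth_on_imp_differentiable[OF smooth_on_partial[OF smooth_metric] assms]]
        by simp
    qed
    then show ?thesis
      using partial_commute[OF open_dom smooth_on_vec_nth[OF open_dom
            smooth_on_vec_nth[OF open_dom smooth_metric]] assms]
      by (simp add: vec_eq_iff)
  qed
  \<comment> \<open>The cross term of \<partial>_i(H C_j) that stems from the transposed half of
    \<partial>_i H. Exchanging i and j transposes it, so it drops out of K + transpose K.\<close>
  define X where "X = transpose (?C i) ** H y ** ?C j"
  have X: "transpose (H y ** ?C i) ** ?C j = X" "transpose (H y ** ?C j) ** ?C i = transpose X"
    by (simp_all add: X_def matrix_transpose_mul metric_sym[OF assms] matrix_mul_assoc)
  define K where "K = H y ** curvature_matrix H i j y"
  have K: "K = partial i (?Q j) y - partial j (?Q i) y - X + transpose X"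
    unfolding K_def curvature_matrix_eq[OF assms] PQ X
    by (simp add: matrix_mul_assoc bounded_bilinear.diff_right[OF bounded_bilinear_matrix_mult]
        matrix_add_ldistrib)
  moreover from K have "transpose K = transpose (partial i (?Q j) y) - transpose (partial j (?Q i) y)
      - transpose X + X"
    by (simp add: vec_eq_iff transpose_def)
  ultimately have "K + transpose K
      = (partial i (?Q j) y + transpose (partial i (?Q j) y))
        - (partial j (?Q i) y + transpose (partial j (?Q i) y))"
    by simp
  then have "K + transpose K = 0"
    using comm unfolding second by simp
  then show ?thesis unfolding K_def by (simp add: eq_neg_iff_add_eq_0 add.commute)
qed

section \<open>Symmetries and traces of the curvature tensor\<close>

lemma curvature_eq:
  "curvature H y u v w = (\<Sum>i\<in>UNIV. \<Sum>j\<in>UNIV. (u $ i * v $ j) *\<^sub>R (curvature_matrix H i j y *v w))"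
  by (simp add: vec_eq_iff curvature_def curvature_matrix_def matrix_vector_mult_def
      sum_distrib_left mult.assoc mult.left_commute)

text \<open>Serves to move a test vector into the last slot of the curvature, which turns the
  curvature term of the bitension field into a Ricci contraction.\<close>

lemma curvature_antisymmetric:
  assumes "y \<in> W"
  shows "z \<bullet> (H y *v curvature H y u v w) = - (w \<bullet> (H y *v curvature H y u v z))"
proof -
  have *: "z \<bullet> (H y *v (curvature_matrix H i j y *v w))
      = - (w \<bullet> (H y *v (curvature_matrix H i j y *v z)))" for i j
  proof -
    let ?K = "H y ** curvature_matrix H i j y"
    have "z \<bullet> (?K *v w) = w \<bullet> (transpose ?K *v z)"
      by (rule inner_transpose_matrix[symmetric])
    then show ?thesis
      unfolding curvature_matrix_antisymmetric[OF assms]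
      by (simp add: matrix_vector_mul_assoc inner_commute
          bounded_bilinear.minus_left[OF bounded_bilinear_matrix_vector_mult])
  qed
  show ?thesis
    by (simp add: curvature_eq linear_sum[OF matrix_vector_mul_linear] inner_sum_right
        matrix_vector_mult_scaleR * sum_negf)
qed

lemma curvature_add: "curvature H y (u + u') v w = curvature H y u v w + curvature H y u' v w"
  by (simp add: curvature_eq sum.distrib algebra_simps)

lemma curvature_scaleR: "curvature H y (c *\<^sub>R u) v w = c *\<^sub>R curvature H y u v w"
  by (simp add: curvature_eq scaleR_sum_right mult.assoc)

text \<open>The commutator formula is skew in i and j, so exchanging the two summation indices turns
  the vector into its negative.\<close>

lemma curvature_same:
  assumes "y \<in> W"
  shows "curvature H y u u w = 0"
proof -
  have swap: "curvature_matrix H i j y = - curvature_matrix H j i y" for i j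
    unfolding curvature_matrix_eq[OF assms] by simp
  have "(u $ i * u $ j) *\<^sub>R (curvature_matrix H i j y *v w)
      = - ((u $ j * u $ i) *\<^sub>R (curvature_matrix H j i y *v w))" for i j
    by (simp add: swap[of i j] bounded_bilinear.minus_left[OF bounded_bilinear_matrix_vector_mult]
        mult.commute)
  then have "curvature H y u u w
      = (\<Sum>i\<in>UNIV. \<Sum>j\<in>UNIV. - ((u $ j * u $ i) *\<^sub>R (curvature_matrix H j i y *v w)))"
    unfolding curvature_eq by (intro sum.cong refl)
  also have "\<dots> = - curvature H y u u w"
    unfolding curvature_eq by (subst sum.swap) (simp add: sum_negf)
  finally show ?thesis
    by (simp add: vec_eq_iff)
qed

text \<open>As the trace of an endomorphism, the contraction can be evaluated in any basis, in
  particular in a tangent frame completed by a normal vector.\<close>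

lemma ricci_eq:
  "v \<bullet> (ricci H y *v w) = trace (matrix (\<lambda>u. curvature H y u v w))"
proof -
  have "curvature H y (axis i 1) v w $ i
      = (\<Sum>j\<in>UNIV. \<Sum>k\<in>UNIV. riem H y i k i j * v $ j * w $ k)" for i
  proof -
    have "curvature H y (axis i 1) v w
      = (\<Sum>s\<in>UNIV. if i = s then \<Sum>j\<in>UNIV. v $ j *\<^sub>R (curvature_matrix H s j y *v w) else 0)"
      unfolding curvature_eq by (intro sum.cong refl) (simp add: axis_def)
    then show ?thesis
      by (simp add: curvature_matrix_def matrix_vector_mult_def sum_distrib_left mult_ac)
  qed
  then have "trace (matrix (\<lambda>u. curvature H y u v w))
      = (\<Sum>i\<in>UNIV. \<Sum>j\<in>UNIV. \<Sum>k\<in>UNIV. riem H y i k i j * v $ j * w $ k)"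
    by (simp add: trace_def matrix_def)
  also have "\<dots> = (\<Sum>j\<in>UNIV. \<Sum>k\<in>UNIV. \<Sum>i\<in>UNIV. riem H y i k i j * v $ j * w $ k)"
    by (subst sum.swap, rule sum.cong[OF refl], rule sum.swap)
  also have "\<dots> = v \<bullet> (ricci H y *v w)"
    by (simp add: inner_vec_def matrix_vector_mult_def ricci_def sum_distrib_left sum_distrib_right mult_ac)
  finally show ?thesis by simp
qed

subsection \<open>The pulled-back connection\<close>

lemma cov_along_eq:
  "cov_along H f i V x = partial i V x
    + (\<Sum>b\<in>UNIV. partial i f x $ b *\<^sub>R connection_matrix H b (f x)) *v V x"
proof -
  have "(\<Sum>b\<in>UNIV. \<Sum>c\<in>UNIV. christoffel H (f x) a b c * partial i f x $ b * V x $ c)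
      = ((\<Sum>b\<in>UNIV. partial i f x $ b *\<^sub>R connection_matrix H b (f x)) *v V x) $ a" for a
    unfolding matrix_vector_mult_def
    by (subst sum.swap)
      (simp add: connection_matrix_def sum_distrib_right sum_distrib_left mult_ac)
  then show ?thesis by (simp add: cov_along_def vec_eq_iff)
qed

text \<open>By the chain rule and \<open>partial_metric\<close>, the derivative of H along f is H A
  plus its transpose, with A the pulled-back connection matrix. The first summand completes the
  derivative of Z, the second that of V.\<close>

lemma partial_inner_along:
  assumes f: "f differentiable at x" and fx: "f x \<in> W"
    and V: "V differentiable at x" and Z: "Z differentiable at x"
  shows "partial i (\<lambda>x. V x \<bullet> (H (f x) *v Z x)) x
    = cov_along H f i V x \<bullet> (H (f x) *v Z x) + V x \<bullet> (H (f x) *v cov_along H f i Z x)"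
proof -
  define A where "A = (\<Sum>b\<in>UNIV. partial i f x $ b *\<^sub>R connection_matrix H b (f x))"
  let ?H = "H (f x)"
  have Hf: "(\<lambda>x. H (f x)) differentiable at x"
    using differentiable_chain_at[OF f metric_differentiable[OF fx]] by (simp add: o_def)
  have "partial i (\<lambda>x. H (f x)) x = ?H ** A + transpose (?H ** A)"
    unfolding partial_compose[OF f metric_differentiable[OF fx]] A_def partial_metric[OF fx]
    by (simp add: scaleR_add_right sum.distrib linear_sum[OF bounded_linear.linear[OF bounded_linear_transpose]]
        bounded_bilinear.sum_right[OF bounded_bilinear_matrix_mult]
        bounded_bilinear.scaleR_right[OF bounded_bilinear_matrix_mult]
        linear_cmul[OF bounded_linear.linear[OF bounded_linear_transpose]])
  moreover have HfZ: "(\<lambda>x. H (f x) *v Z x) differentiable at x"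
    by (rule differentiable_bounded_bilinear[OF bounded_bilinear_matrix_vector_mult Hf Z])
  moreover have "V x \<bullet> (transpose (?H ** A) *v Z x) = (A *v V x) \<bullet> (?H *v Z x)"
  proof -
    have "V x \<bullet> (transpose (?H ** A) *v Z x) = Z x \<bullet> ((?H ** A) *v V x)"
      by (rule inner_transpose_matrix)
    also have "\<dots> = (A *v V x) \<bullet> (?H *v Z x)"
      using inner_symmetric_matrix[OF metric_sym[OF fx]] by (simp add: matrix_vector_mul_assoc[symmetric])
    finally show ?thesis .
  qed
  ultimately show ?thesis
    unfolding cov_along_eq A_def[symmetric]
    by (simp add: partial_bounded_bilinear[OF bounded_bilinear_inner V HfZ]
        partial_bounded_bilinear[OF bounded_bilinear_matrix_vector_mult Hf Z]
        matrix_vector_mult_add_rdistrib matrix_vector_right_distrib inner_add_left inner_add_right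
        matrix_vector_mul_assoc)
qed

text \<open>Vanishing torsion: both the second partial derivatives of f and the Christoffel symbols
  are symmetric.\<close>

lemma cov_along_partial_commute:
  assumes "open U" "smooth_on U f" "x \<in> U" "f x \<in> W"
  shows "cov_along H f i (partial j f) x = cov_along H f j (partial i f) x"
proof -
  have "(\<Sum>b\<in>UNIV. \<Sum>c\<in>UNIV. christoffel H (f x) a b c * partial i f x $ b * partial j f x $ c)
      = (\<Sum>b\<in>UNIV. \<Sum>c\<in>UNIV. christoffel H (f x) a b c * partial j f x $ b * partial i f x $ c)" for a
    by (subst sum.swap) (simp add: christoffel_commute[OF assms(4), of a] mult_ac)
  then show ?thesis
    unfolding cov_along_def partial_commute_vec[OF assms(1-3), of i j] by simp
qed

lemma smooth_on_cov_along:
  assumes "open U" "smooth_on U f" "f ` U \<subseteq> W" "smooth_on U V"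
  shows "smooth_on U (cov_along H f i V)"
proof -
  have conn: "smooth_on U (\<lambda>x. connection_matrix H b (f x))" for b
    by (rule smooth_on_compose[OF assms(1) open_dom assms(3,2) smooth_connection_matrix])
  have coeff: "smooth_on U (\<lambda>x. partial i f x $ b)" for b
    by (rule smooth_on_vec_nth[OF assms(1) smooth_on_partial[OF assms(2)]])
  show ?thesis
    unfolding cov_along_eq[abs_def]
    by (rule smooth_on_add[OF assms(1) smooth_on_partial[OF assms(4)]
          smooth_on_bounded_bilinear[OF bounded_bilinear_matrix_vector_mult assms(1)
            smooth_on_sum[OF assms(1) smooth_on_scaleR[OF assms(1) coeff conn]] assms(4)]])
qed

end

subsection \<open>Linear algebra of a hyperplane with a normal vector\<close>

lemma linear_inj_imp_DIM_le:
  fixes L :: "'a::euclidean_space \<Rightarrow> 'b::euclidean_space"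
  assumes "linear L" "inj L"
  shows "DIM('a) \<le> DIM('b)"
proof -
  have "dim (range L) = dim (UNIV :: 'a set)"
    using assms by (intro dim_image_eq) auto
  then show ?thesis using dim_subset_UNIV[of "range L"] by simp
qed

lemma linear_inj_imp_surj_DIM:
  fixes L :: "'a::euclidean_space \<Rightarrow> 'b::euclidean_space"
  assumes "linear L" "inj L" "DIM('a) = DIM('b)"
  shows "surj L"
proof -
  have "dim (range L) = dim (UNIV :: 'a set)"
    using assms by (intro dim_image_eq) auto
  then have "dim (range L) = DIM('b)" using assms(3) by simp
  then have "span (range L) = UNIV" by (simp only: dim_eq_full)
  then show ?thesis
    using span_linear_image[OF assms(1), of UNIV] by simp
qed

text \<open>Linear independence of \<open>e\<close> is encoded by the positivity of its Gram matrix \<open>G\<close>.\<close>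

locale hyperplane_basis =
  fixes H :: "real ^ 'n ^ 'n" and e :: "'m::finite \<Rightarrow> real ^ 'n::finite" and G :: "real ^ 'm ^ 'm"
  assumes H_sym: "transpose H = H"
    and H_pos: "v \<noteq> 0 \<Longrightarrow> 0 < v \<bullet> (H *v v)"
    and G_nth: "G $ i $ j = e i \<bullet> (H *v e j)"
    and G_pos: "a \<noteq> 0 \<Longrightarrow> 0 < a \<bullet> (G *v a)"
    and card: "CARD('n) = CARD('m) + 1"
begin

lemma H_commute: "v \<bullet> (H *v w) = w \<bullet> (H *v v)"
  by (rule inner_symmetric_matrix[OF H_sym])

lemma H_eq_0: "v \<bullet> (H *v v) = 0 \<Longrightarrow> v = 0"
  using H_pos[of v] by force

lemma G_invertible: "invertible G"
  by (rule positive_definite_invertible) (rule G_pos)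

lemma G_matrix_inv: "(\<Sum>j\<in>UNIV. G $ i $ j * matrix_inv G $ j $ k) = (if i = k then 1 else 0)"
  using matrix_inv_right[OF G_invertible]
  by (simp add: vec_eq_iff matrix_matrix_mult_def mat_def)

lemma matrix_inv_G: "(\<Sum>j\<in>UNIV. matrix_inv G $ i $ j * G $ j $ k) = (if i = k then 1 else 0)"
  using matrix_inv_left[OF G_invertible]
  by (simp add: vec_eq_iff matrix_matrix_mult_def mat_def)

lemma G_commute: "G $ i $ j = G $ j $ i"
  unfolding G_nth by (rule H_commute)

lemma trace_G: "(\<Sum>i\<in>UNIV. \<Sum>j\<in>UNIV. matrix_inv G $ i $ j * G $ i $ j) = real CARD('m)"
  using matrix_inv_G by (subst G_commute) simp

lemma combination_inner:
  "(\<Sum>i\<in>UNIV. a $ i *\<^sub>R e i) \<bullet> (H *v (\<Sum>i\<in>UNIV. a $ i *\<^sub>R e i)) = a \<bullet> (G *v a)"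
proof -
  have "a \<bullet> (G *v a) = (\<Sum>i\<in>UNIV. \<Sum>j\<in>UNIV. a $ i * (a $ j * (e i \<bullet> (H *v e j))))"
    by (simp add: inner_vec_def[of a] matrix_vector_mult_def[of G] G_nth sum_distrib_left mult_ac)
  then show ?thesis
    by (simp add: linear_sum[OF matrix_vector_mul_linear] matrix_vector_mult_scaleR
        inner_sum_left inner_sum_right[of "e _"] sum_distrib_left)
qed

text \<open>Pairing with the m vectors \<open>e i\<close> is a linear map from dimension m + 1 to
  dimension m, so it has a nonzero kernel vector, which is then normalised.\<close>

lemma exists_unit_normal:
  obtains \<xi> where "\<And>i. e i \<bullet> (H *v \<xi>) = 0" "\<xi> \<bullet> (H *v \<xi>) = 1"
proof -
  let ?L = "\<lambda>\<xi>. (\<chi> i. e i \<bullet> (H *v \<xi>)) :: real ^ 'm"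
  have lin: "linear ?L"
    by (rule linearI) (simp_all add: vec_eq_iff matrix_vector_right_distrib inner_add_right
        matrix_vector_mult_scaleR)
  have "\<not> inj ?L"
  proof
    assume "inj ?L"
    from linear_inj_imp_DIM_le[OF lin this] show False using card by simp
  qed
  then obtain v where v: "?L v = 0" "v \<noteq> 0"
    unfolding linear_injective_0[OF lin] by blast
  define q where "q = v \<bullet> (H *v v)"
  have q: "0 < q" unfolding q_def by (rule H_pos[OF v(2)])
  have "e i \<bullet> (H *v ((1 / sqrt q) *\<^sub>R v)) = 0" for i
    using v(1) by (simp add: vec_eq_iff matrix_vector_mult_scaleR)
  moreover have "((1 / sqrt q) *\<^sub>R v) \<bullet> (H *v ((1 / sqrt q) *\<^sub>R v)) = 1"
    using q by (simp add: matrix_vector_mult_scaleR flip: q_def)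
  ultimately show ?thesis by (rule that)
qed

text \<open>A dimension count: the \<open>e i\<close> and \<nu> are m + 1 independent vectors in
  dimension m + 1, hence they span, and w is orthogonal to itself.\<close>

lemma orthogonal_eq_0:
  assumes \<nu>: "\<And>i. e i \<bullet> (H *v \<nu>) = 0" "\<nu> \<noteq> 0"
    and w: "\<And>i. e i \<bullet> (H *v w) = 0" "\<nu> \<bullet> (H *v w) = 0"
  shows "w = 0"
proof -
  let ?L = "\<lambda>p :: (real ^ 'm) \<times> real. (\<Sum>i\<in>UNIV. fst p $ i *\<^sub>R e i) + snd p *\<^sub>R \<nu>"
  have lin: "linear ?L"
    by (rule linearI) (simp_all add: scaleR_add_left sum.distrib scaleR_sum_right scaleR_add_right)
  have "p = 0" if "?L p = 0" for p
  proof -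
    let ?t = "\<Sum>i\<in>UNIV. fst p $ i *\<^sub>R e i"
    \<comment> \<open>Pairing a vanishing combination with \<nu> isolates the coefficient of \<nu>;
      positivity of the Gram matrix then removes the others.\<close>
    have "\<nu> \<bullet> (H *v ?t) = 0"
      by (simp add: linear_sum[OF matrix_vector_mul_linear] matrix_vector_mult_scaleR
          inner_sum_right H_commute[of \<nu>] \<nu>(1))
    then have "\<nu> \<bullet> (H *v ?L p) = snd p * (\<nu> \<bullet> (H *v \<nu>))"
      by (simp add: matrix_vector_right_distrib inner_add_right matrix_vector_mult_scaleR)
    then have "snd p = 0" using that H_pos[OF \<nu>(2)] by simp
    then have "fst p \<bullet> (G *v fst p) = 0"
      using that combination_inner[of "fst p"] by simp
    then have "fst p = 0" using G_pos[of "fst p"] by force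
    with \<open>snd p = 0\<close> show ?thesis by (simp add: prod_eq_iff)
  qed
  then have "inj ?L" unfolding linear_injective_0[OF lin] by blast
  moreover have "DIM((real ^ 'm) \<times> real) = DIM(real ^ 'n)" using card by simp
  ultimately have "surj ?L" by (rule linear_inj_imp_surj_DIM[OF lin])
  then obtain p where p: "w = ?L p" by (rule surjE)
  have "?L p \<bullet> (H *v w) = 0"
    using w by (simp add: inner_add_left inner_sum_left)
  then show ?thesis using p H_eq_0 by simp
qed

text \<open>The difference of the two sides is orthogonal to every \<open>e k\<close> and to \<nu>.
  The normal vector has arbitrary length, hence the quotient; later \<tau> itself takes its
  place.\<close>

lemma expand:
  assumes \<nu>: "\<And>i. e i \<bullet> (H *v \<nu>) = 0" "\<nu> \<noteq> 0"
  shows "w = (\<Sum>i\<in>UNIV. \<Sum>j\<in>UNIV. (matrix_inv G $ i $ j * (e j \<bullet> (H *v w))) *\<^sub>R e i)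
    + (\<nu> \<bullet> (H *v w) / (\<nu> \<bullet> (H *v \<nu>))) *\<^sub>R \<nu>"
proof -
  let ?t = "\<Sum>i\<in>UNIV. \<Sum>j\<in>UNIV. (matrix_inv G $ i $ j * (e j \<bullet> (H *v w))) *\<^sub>R e i"
  let ?n = "(\<nu> \<bullet> (H *v w) / (\<nu> \<bullet> (H *v \<nu>))) *\<^sub>R \<nu>"
  have "e k \<bullet> (H *v ?t) = e k \<bullet> (H *v w)" for k
  proof -
    have "e k \<bullet> (H *v ?t)
        = (\<Sum>i\<in>UNIV. \<Sum>j\<in>UNIV. G $ k $ i * matrix_inv G $ i $ j * (e j \<bullet> (H *v w)))"
      by (simp add: linear_sum[OF matrix_vector_mul_linear] matrix_vector_mult_scaleR
          inner_sum_right G_nth mult_ac)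
    also have "\<dots> = (\<Sum>j\<in>UNIV. (\<Sum>i\<in>UNIV. G $ k $ i * matrix_inv G $ i $ j) * (e j \<bullet> (H *v w)))"
      by (subst sum.swap) (simp add: sum_distrib_right)
    also have "\<dots> = e k \<bullet> (H *v w)"
      unfolding G_matrix_inv by (simp add: if_distrib[of "\<lambda>c. c * _"] cong: if_cong)
    finally show ?thesis .
  qed
  moreover have "e k \<bullet> (H *v ?n) = 0" for k
    by (simp add: matrix_vector_mult_scaleR \<nu>(1))
  moreover have "\<nu> \<bullet> (H *v ?t) = 0"
    by (simp add: linear_sum[OF matrix_vector_mul_linear] matrix_vector_mult_scaleR
        inner_sum_right H_commute[of \<nu>] \<nu>(1))
  moreover have "\<nu> \<bullet> (H *v ?n) = \<nu> \<bullet> (H *v w)"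
    using H_pos[OF \<nu>(2)] by (simp add: matrix_vector_mult_scaleR)
  ultimately have "w - (?t + ?n) = 0"
    by (intro orthogonal_eq_0[OF \<nu>])
      (simp_all add: matrix_vector_mult_diff_distrib matrix_vector_right_distrib
        inner_diff_right inner_add_right)
  then show ?thesis by simp
qed

text \<open>T is applied to the expansion of each coordinate vector, and the diagonal entries are
  summed; symmetry of H reassembles the inner products.\<close>

lemma trace_expand:
  assumes \<nu>: "\<And>i. e i \<bullet> (H *v \<nu>) = 0" "\<nu> \<noteq> 0" and T: "linear T"
  shows "trace (matrix T) = (\<Sum>i\<in>UNIV. \<Sum>j\<in>UNIV. matrix_inv G $ i $ j * (e j \<bullet> (H *v T (e i))))
    + \<nu> \<bullet> (H *v T \<nu>) / (\<nu> \<bullet> (H *v \<nu>))"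
proof -
  let ?u = "\<nu> \<bullet> (H *v \<nu>)"
  have T_axis: "T (axis a 1) = (\<Sum>i\<in>UNIV. \<Sum>j\<in>UNIV. (matrix_inv G $ i $ j * (H *v e j) $ a) *\<^sub>R T (e i))
      + ((H *v \<nu>) $ a / ?u) *\<^sub>R T \<nu>" for a
  proof -
    have "z \<bullet> (H *v axis a 1) = (H *v z) $ a" for z
      unfolding H_commute[of z] by (simp add: inner_axis inner_commute[of "axis a 1"])
    then show ?thesis
      by (subst expand[OF \<nu>, of "axis a 1"])
        (simp add: linear_add[OF T] linear_sum[OF T] linear_cmul[OF T])
  qed
  have "trace (matrix T) = (\<Sum>a\<in>UNIV. T (axis a 1) $ a)"
    by (simp add: trace_def matrix_def)
  also have "\<dots> = (\<Sum>a\<in>UNIV. \<Sum>i\<in>UNIV. \<Sum>j\<in>UNIV. matrix_inv G $ i $ j * ((H *v e j) $ a * T (e i) $ a))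
      + (\<Sum>a\<in>UNIV. (H *v \<nu>) $ a * T \<nu> $ a) / ?u"
    unfolding T_axis by (simp add: sum.distrib sum_divide_distrib mult.assoc)
  also have "(\<Sum>a\<in>UNIV. \<Sum>i\<in>UNIV. \<Sum>j\<in>UNIV. matrix_inv G $ i $ j * ((H *v e j) $ a * T (e i) $ a))
      = (\<Sum>i\<in>UNIV. \<Sum>j\<in>UNIV. \<Sum>a\<in>UNIV. matrix_inv G $ i $ j * ((H *v e j) $ a * T (e i) $ a))"
    by (subst sum.swap, rule sum.cong[OF refl], rule sum.swap)
  also have "\<dots> = (\<Sum>i\<in>UNIV. \<Sum>j\<in>UNIV. matrix_inv G $ i $ j * (e j \<bullet> (H *v T (e i))))"
    unfolding H_commute[of "e _"] by (simp add: inner_vec_def sum_distrib_left mult.commute)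
  also have "(\<Sum>a\<in>UNIV. (H *v \<nu>) $ a * T \<nu> $ a) = \<nu> \<bullet> (H *v T \<nu>)"
    unfolding H_commute[of \<nu>] by (simp add: inner_vec_def mult.commute)
  finally show ?thesis .
qed

end

subsection \<open>Symmetric matrices with a single generalised eigenvalue\<close>

text \<open>Since v minimises the form, the quadratic polynomial obtained along the line v + t B v
  is nonnegative for all t, which leaves no room for its linear term.\<close>

lemma positive_semidefinite_kernel:
  fixes B :: "real ^ 'n ^ 'n"
  assumes B: "transpose B = B" and pos: "\<And>v. 0 \<le> v \<bullet> (B *v v)" and v: "v \<bullet> (B *v v) = 0"
  shows "B *v v = 0"
proof -
  define w where "w = B *v v"
  define c where "c = w \<bullet> (B *v w)"
  have "(v + t *\<^sub>R w) \<bullet> (B *v (v + t *\<^sub>R w)) = 2 * t * (w \<bullet> w) + t * t * c" for t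
    using v inner_symmetric_matrix[OF B, of v w]
    by (simp add: matrix_vector_right_distrib matrix_vector_mult_scaleR inner_add_left
        inner_add_right c_def distrib_left mult_ac flip: w_def)
  then have t: "0 \<le> 2 * t * (w \<bullet> w) + t * t * c" for t
    using pos[of "v + t *\<^sub>R w"] by simp
  have "w \<bullet> w = 0"
  proof (cases "c = 0")
    case True
    then show ?thesis using t[of "-1"] inner_ge_zero[of w] by simp
  next
    case False
    then have "0 < c" using pos[of w] by (simp add: c_def)
    \<comment> \<open>The chosen t is the minimiser of the quadratic polynomial.\<close>
    then have "0 \<le> - (w \<bullet> w)\<^sup>2 / c"
      using t[of "- (w \<bullet> w) / c"] by (simp add: power2_eq_square)
    then have "(w \<bullet> w)\<^sup>2 \<le> 0" using \<open>0 < c\<close> by (simp add: field_simps)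
    then show ?thesis by simp
  qed
  then show ?thesis by (simp add: w_def)
qed

text \<open>The maximiser of the generalised Rayleigh quotient is an eigenvector.\<close>

lemma generalised_max_eigenvalue:
  fixes A G :: "real ^ 'n ^ 'n"
  assumes A: "transpose A = A" and G: "transpose G = G" "\<And>v. v \<noteq> 0 \<Longrightarrow> 0 < v \<bullet> (G *v v)"
  obtains \<kappa> v where "v \<noteq> 0" "A *v v = \<kappa> *\<^sub>R (G *v v)" "\<And>w. w \<bullet> (A *v w) \<le> \<kappa> * (w \<bullet> (G *v w))"
proof -
  let ?S = "sphere (0 :: real ^ 'n) 1"
  let ?q = "\<lambda>v. v \<bullet> (A *v v) / (v \<bullet> (G *v v))"
  have nz: "v \<bullet> (G *v v) \<noteq> 0" if "v \<in> ?S" for v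
    using G(2)[of v] that by force
  have "continuous_on ?S ?q"
    using nz by (intro continuous_on_divide continuous_on_inner continuous_on_id
        bounded_linear.continuous_on[OF matrix_vector_mul_bounded_linear]) auto
  moreover have "?S \<noteq> {}"
    by (simp add: vector_choose_size)
  ultimately obtain v where v: "v \<in> ?S" "\<And>w. w \<in> ?S \<Longrightarrow> ?q w \<le> ?q v"
    using continuous_attains_sup[OF compact_sphere] by blast
  define \<kappa> where "\<kappa> = ?q v"
  have le: "w \<bullet> (A *v w) \<le> \<kappa> * (w \<bullet> (G *v w))" for w
  proof (cases "w = 0")
    case False
    have "?q (w /\<^sub>R norm w) \<le> \<kappa>"
      unfolding \<kappa>_def using False by (intro v(2)) simp
    also have "?q (w /\<^sub>R norm w) = ?q w"
      using False by (simp add: matrix_vector_mult_scaleR field_simps)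
    finally show ?thesis using G(2)[OF False] by (simp add: pos_divide_le_eq)
  qed simp
  \<comment> \<open>By maximality of \<kappa> this matrix is positive semidefinite with v as a null
    vector of its form, so v lies in its kernel. This replaces differentiating the quotient.\<close>
  define B where "B = \<kappa> *\<^sub>R G - A"
  have Bq: "w \<bullet> (B *v w) = \<kappa> * (w \<bullet> (G *v w)) - w \<bullet> (A *v w)" for w
    by (simp add: B_def matrix_vector_mult_diff_rdistrib inner_diff_right
        flip: scaleR_matrix_vector_assoc)
  have "transpose B = \<kappa> *\<^sub>R transpose G - transpose A"
    unfolding B_def by (simp add: vec_eq_iff transpose_def)
  then have "transpose B = B" using A G(1) by (simp add: B_def)
  then have "B *v v = 0"
    by (rule positive_semidefinite_kernel) (use le nz[OF v(1)] in \<open>simp_all add: Bq \<kappa>_def\<close>)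
  then have "A *v v = \<kappa> *\<^sub>R (G *v v)"
    by (simp add: B_def matrix_vector_mult_diff_rdistrib flip: scaleR_matrix_vector_assoc)
  moreover have "v \<noteq> 0" using v(1) by auto
  ultimately show ?thesis using le that by blast
qed

text \<open>The largest eigenvalue of A and that of -A are l and -l, so the form of A - l G is
  squeezed to zero from both sides. A symmetric matrix with zero form vanishes by the kernel
  lemma.\<close>

lemma single_eigenvalue_imp_scalar:
  fixes A G :: "real ^ 'n ^ 'n"
  assumes A: "transpose A = A" and G: "transpose G = G" "\<And>v. v \<noteq> 0 \<Longrightarrow> 0 < v \<bullet> (G *v v)"
    and single: "\<And>\<kappa> v. \<lbrakk>v \<noteq> 0; A *v v = \<kappa> *\<^sub>R (G *v v)\<rbrakk> \<Longrightarrow> \<kappa> = l"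
  shows "A = l *\<^sub>R G"
proof -
  obtain \<kappa> v where 1: "v \<noteq> 0" "A *v v = \<kappa> *\<^sub>R (G *v v)" "\<And>w. w \<bullet> (A *v w) \<le> \<kappa> * (w \<bullet> (G *v w))"
    by (rule generalised_max_eigenvalue[OF A G(1)]) (assumption | rule G(2) that)+
  have A': "transpose (- A) = - A"
    using A by (simp add: vec_eq_iff transpose_def)
  have neg: "(- A) *v w = - (A *v w)" for w
    by (rule bounded_bilinear.minus_left[OF bounded_bilinear_matrix_vector_mult])
  obtain \<mu> z where 2: "z \<noteq> 0" "(- A) *v z = \<mu> *\<^sub>R (G *v z)"
      "\<And>w. w \<bullet> ((- A) *v w) \<le> \<mu> * (w \<bullet> (G *v w))"
    by (rule generalised_max_eigenvalue[OF A' G(1)]) (assumption | rule G(2) that)+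
  have "A *v z = (- \<mu>) *\<^sub>R (G *v z)"
    using arg_cong[OF 2(2), of uminus] unfolding neg by simp
  then have l: "\<kappa> = l" "\<mu> = - l"
    using single[OF 1(1,2)] single[OF 2(1), of "- \<mu>"] by simp_all
  define B where "B = A - l *\<^sub>R G"
  have "w \<bullet> (B *v w) = w \<bullet> (A *v w) - l * (w \<bullet> (G *v w))" for w
    by (simp add: B_def matrix_vector_mult_diff_rdistrib inner_diff_right
        flip: scaleR_matrix_vector_assoc)
  then have zero: "w \<bullet> (B *v w) = 0" for w
    using 1(3)[of w] 2(3)[of w] unfolding neg l by simp
  have "transpose B = transpose A - l *\<^sub>R transpose G"
    unfolding B_def by (simp add: vec_eq_iff transpose_def)
  then have "transpose B = B" using A G(1) by (simp add: B_def)
  then have "B *v w = 0" for w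
    by (rule positive_semidefinite_kernel) (simp_all add: zero)
  then have "B = 0" unfolding matrix_eq by simp
  then show ?thesis by (simp add: B_def)
qed

subsection \<open>Hypersurfaces in coordinates\<close>

text \<open>The immersion in one pair of charts: U is the part of the source chart that is mapped
  into the target chart W.\<close>

locale local_hypersurface =
  source: local_metric U G + target: local_metric W H
  for U :: "(real ^ 'm::finite) set" and G :: "real ^ 'm \<Rightarrow> real ^ 'm ^ 'm"
    and W :: "(real ^ 'n::finite) set" and H :: "real ^ 'n \<Rightarrow> real ^ 'n ^ 'n" +
  fixes f :: "real ^ 'm \<Rightarrow> real ^ 'n"
  assumes smooth: "smooth_on U f"
    and maps_into: "x \<in> U \<Longrightarrow> f x \<in> W"
    and induced: "x \<in> U \<Longrightarrow> G x = pullback H f x"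
    and codimension: "CARD('n) = CARD('m) + 1"
begin

definition ip :: "real ^ 'm \<Rightarrow> real ^ 'n \<Rightarrow> real ^ 'n \<Rightarrow> real" where
  "ip x v w = v \<bullet> (H (f x) *v w)"

abbreviation "\<tau> \<equiv> tension G H f"
abbreviation "D \<equiv> cov_along H f"
abbreviation "e i \<equiv> partial i f"
abbreviation "\<Gamma> \<equiv> christoffel G"

lemma ip_linear:
  "ip x (v + v') w = ip x v w + ip x v' w"
  "ip x v (w + w') = ip x v w + ip x v w'"
  "ip x (v - v') w = ip x v w - ip x v' w"
  "ip x v (w - w') = ip x v w - ip x v w'"
  "ip x (c *\<^sub>R v) w = c * ip x v w"
  "ip x v (c *\<^sub>R w) = c * ip x v w"
  "ip x (sum V I) w = (\<Sum>i\<in>I. ip x (V i) w)"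
  "ip x v (sum V I) = (\<Sum>i\<in>I. ip x v (V i))"
  "ip x (- v) w = - ip x v w" "ip x v (- w) = - ip x v w"
  "ip x 0 w = 0" "ip x v 0 = 0"
  by (simp_all add: ip_def inner_add_left inner_add_right inner_diff_left inner_diff_right
      matrix_vector_right_distrib matrix_vector_mult_diff_distrib matrix_vector_mult_scaleR
      inner_sum_left inner_sum_right linear_sum[OF matrix_vector_mul_linear]
      bounded_bilinear.minus_right[OF bounded_bilinear_matrix_vector_mult])

text \<open>That g is induced says precisely that it is the Gram matrix of the columns of the
  Jacobian.\<close>

lemma frame:
  assumes "x \<in> U"
  shows "hyperplane_basis (H (f x)) (\<lambda>i. e i x) (G x)"
proof
  have col: "jacobian f (at x) *v axis i 1 = e i x" for i
    by (simp add: jacobian_def partial_def matrix_vector_mult_basis matrix_def column_def vec_eq_iff)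
  have "G x $ i $ j = axis i 1 \<bullet> (G x *v axis j 1)" for i j
    by (simp add: inner_axis inner_commute[of "axis i 1"] matrix_vector_mult_basis column_def)
  also have "\<dots> i j = e i x \<bullet> (H (f x) *v e j x)" for i j
    unfolding induced[OF assms] pullback_def
    by (simp only: matrix_vector_mul_assoc[symmetric] inner_transpose_matrix col)
      (simp only: inner_commute)
  finally show "G x $ i $ j = e i x \<bullet> (H (f x) *v e j x)" for i j .
qed (use target.metric_sym target.metric_pos source.metric_pos maps_into assms codimension in simp_all)

lemma G_nth: "x \<in> U \<Longrightarrow> G x $ i $ j = ip x (e i x) (e j x)"
  unfolding ip_def by (rule hyperplane_basis.G_nth[OF frame])

lemma ip_commute: "x \<in> U \<Longrightarrow> ip x v w = ip x w v"
  unfolding ip_def by (rule hyperplane_basis.H_commute[OF frame])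

lemma ip_pos: "x \<in> U \<Longrightarrow> v \<noteq> 0 \<Longrightarrow> 0 < ip x v v"
  unfolding ip_def by (rule hyperplane_basis.H_pos[OF frame])

lemma smooth_e: "smooth_on U (e i)"
  by (rule smooth_on_partial[OF smooth])

lemma smooth_D: "smooth_on U V \<Longrightarrow> smooth_on U (D i V)"
  by (rule target.smooth_on_cov_along[OF source.open_dom smooth]) (auto intro: maps_into)

lemma partial_ip:
  assumes "x \<in> U" "smooth_on U V" "smooth_on U Z"
  shows "partial i (\<lambda>x. ip x (V x) (Z x)) x = ip x (D i V x) (Z x) + ip x (V x) (D i Z x)"
  unfolding ip_def
  by (rule target.partial_inner_along[OF smooth_on_imp_differentiable[OF smooth assms(1)]
        maps_into[OF assms(1)] smooth_on_imp_differentiable[OF assms(2,1)]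
        smooth_on_imp_differentiable[OF assms(3,1)]])

lemma D_e_commute: "x \<in> U \<Longrightarrow> D i (e j) x = D j (e i) x"
  by (rule target.cov_along_partial_commute[OF source.open_dom smooth _ maps_into])

lemma partial_G:
  assumes "x \<in> U"
  shows "partial i (\<lambda>y. G y $ j $ k) x = ip x (D i (e j) x) (e k x) + ip x (D i (e k) x) (e j x)"
proof -
  have "partial i (\<lambda>y. G y $ j $ k) x = partial i (\<lambda>y. ip y (e j y) (e k y)) x"
    by (rule partial_cong[OF source.open_dom assms G_nth])
  then show ?thesis
    by (simp only: partial_ip[OF assms smooth_e smooth_e] ip_commute[OF assms, of "e j x"])
qed

text \<open>Koszul's formula on both sides.\<close>

lemma ip_D_e:
  assumes "x \<in> U"
  shows "ip x (D i (e j) x) (e k x) = (\<Sum>l\<in>UNIV. G x $ k $ l * \<Gamma> x l i j)"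
  unfolding source.lower_christoffel[OF assms] partial_G[OF assms]
    D_e_commute[OF assms, of j i] D_e_commute[OF assms, of k i] D_e_commute[OF assms, of k j]
  by simp

lemma D_e: "D i (e j) x = second_ff G H f x i j + (\<Sum>k\<in>UNIV. \<Gamma> x k i j *\<^sub>R e k x)"
  by (simp add: second_ff_def)

text \<open>The Christoffel symbols of the induced metric already account for the whole tangential
  part of \<open>D i (e j)\<close>, by \<open>ip_D_e\<close>.\<close>

lemma second_ff_normal:
  assumes "x \<in> U"
  shows "ip x (second_ff G H f x i j) (e k x) = 0"
  using ip_D_e[OF assms, of i j k]
  by (simp add: D_e ip_linear G_nth[OF assms] ip_commute[OF assms, of "e k x"] mult.commute)

lemma second_ff_commute:
  assumes "x \<in> U"
  shows "second_ff G H f x i j = second_ff G H f x j i"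
  unfolding second_ff_def D_e_commute[OF assms, of i j] source.christoffel_commute[OF assms, of _ i j] ..

lemma tension_normal: "x \<in> U \<Longrightarrow> ip x (\<tau> x) (e k x) = 0"
  by (simp add: tension_def ip_linear second_ff_normal)

lemma smooth_tension: "smooth_on U \<tau>"
proof -
  have "smooth_on U (\<lambda>x. matrix_inv (G x))"
    by (rule smooth_on_matrix_inv[OF source.open_dom source.smooth_metric source.metric_invertible])
  then have inv: "smooth_on U (\<lambda>x. matrix_inv (G x) $ i $ j)" for i j
    by (rule smooth_on_vec_nth[OF source.open_dom smooth_on_vec_nth[OF source.open_dom]])
  have ff: "smooth_on U (\<lambda>x. second_ff G H f x i j)" for i j
    unfolding second_ff_def
    by (rule smooth_on_diff[OF source.open_dom smooth_D[OF smooth_e] smooth_on_sum[OF source.open_dom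
            smooth_on_scaleR[OF source.open_dom source.smooth_christoffel smooth_e]]])
  show ?thesis
    unfolding tension_def[abs_def]
    by (rule smooth_on_sum[OF source.open_dom smooth_on_sum[OF source.open_dom
            smooth_on_scaleR[OF source.open_dom inv ff]]])
qed

section \<open>Unit normals, mean curvature and umbilicity at a point\<close>

lemma unit_normal_iff:
  "unit_normal H f x \<xi> \<longleftrightarrow> (\<forall>i. ip x (e i x) \<xi> = 0) \<and> ip x \<xi> \<xi> = 1"
  by (simp add: unit_normal_def ip_def)

lemma unit_normal_exists:
  assumes "x \<in> U"
  obtains \<xi> where "unit_normal H f x \<xi>"
  using hyperplane_basis.exists_unit_normal[OF frame[OF assms]] unfolding unit_normal_def by metis

text \<open>In codimension one the normal space is a line.\<close>

lemma normal_eq_scaleR_unit_normal: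
  assumes "x \<in> U" "unit_normal H f x \<xi>" "\<And>k. ip x w (e k x) = 0"
  shows "w = ip x w \<xi> *\<^sub>R \<xi>"
proof -
  note \<xi> = assms(2)[unfolded unit_normal_iff]
  have "\<xi> \<noteq> 0" using \<xi> by (auto simp: ip_linear)
  have "w - ip x w \<xi> *\<^sub>R \<xi> = 0"
  proof (rule hyperplane_basis.orthogonal_eq_0[OF frame[OF assms(1)], folded ip_def])
    show "ip x (e i x) \<xi> = 0" for i using \<xi> by blast
    show "ip x (e i x) (w - ip x w \<xi> *\<^sub>R \<xi>) = 0" for i
      using \<xi> assms(3) by (simp add: ip_linear ip_commute[OF assms(1), of "e i x" w])
    show "ip x \<xi> (w - ip x w \<xi> *\<^sub>R \<xi>) = 0"
      using \<xi> by (simp add: ip_linear ip_commute[OF assms(1), of \<xi> w])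
  qed fact
  then show ?thesis by simp
qed

lemma mean_curvature_eq:
  assumes "x \<in> U"
  shows "mean_curvature G H f x \<xi> = ip x (\<tau> x) \<xi> / real CARD('m)"
proof -
  have "trace (shape_operator G H f x \<xi>)
      = (\<Sum>i\<in>UNIV. \<Sum>j\<in>UNIV. matrix_inv (G x) $ i $ j * ip x (second_ff G H f x j i) \<xi>)"
    by (simp add: shape_operator_def trace_def matrix_matrix_mult_def ip_def)
  also have "\<dots> = ip x (\<tau> x) \<xi>"
    by (simp add: tension_def ip_linear second_ff_commute[OF assms])
  finally show ?thesis by (simp add: mean_curvature_def)
qed

text \<open>The tension field is normal, hence a multiple of a unit normal, with factor m times the
  mean curvature. The existence of a unit normal keeps the left side from being vacuous.\<close>

lemma mean_curvature_zero_iff: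
  assumes "x \<in> U"
  shows "(\<forall>\<xi>. unit_normal H f x \<xi> \<longrightarrow> mean_curvature G H f x \<xi> = 0) \<longleftrightarrow> \<tau> x = 0"
proof
  assume *: "\<forall>\<xi>. unit_normal H f x \<xi> \<longrightarrow> mean_curvature G H f x \<xi> = 0"
  obtain \<xi> where \<xi>: "unit_normal H f x \<xi>" by (rule unit_normal_exists[OF assms])
  then have "ip x (\<tau> x) \<xi> = 0" using * by (simp add: mean_curvature_eq[OF assms])
  then show "\<tau> x = 0"
    using normal_eq_scaleR_unit_normal[OF assms \<xi> tension_normal[OF assms]] by simp
qed (simp add: mean_curvature_eq[OF assms] ip_linear)

text \<open>Multiplied by g, the eigenvalue equation of the shape operator becomes h v = \<kappa> g
  v with h symmetric, so \<open>single_eigenvalue_imp_scalar\<close> applies.\<close>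

lemma umbilical_second_ff:
  assumes x: "x \<in> U"
    and umb: "\<And>\<xi>. unit_normal H f x \<xi> \<Longrightarrow> \<exists>l. \<forall>\<kappa>\<in>principal_curvatures G H f x \<xi>. \<kappa> = l"
  shows "second_ff G H f x i j = (G x $ i $ j / real CARD('m)) *\<^sub>R \<tau> x"
proof -
  interpret hyperplane_basis "H (f x)" "\<lambda>i. e i x" "G x" by (rule frame[OF x])
  obtain \<xi> where \<xi>: "unit_normal H f x \<xi>" by (rule unit_normal_exists[OF x])
  then obtain l where l: "\<And>\<kappa>. \<kappa> \<in> principal_curvatures G H f x \<xi> \<Longrightarrow> \<kappa> = l"
    using umb by blast
  define h where "h = (\<chi> i j. second_ff G H f x i j \<bullet> (H (f x) *v \<xi>))"
  have "transpose h = h"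
    by (simp add: h_def transpose_def vec_eq_iff second_ff_commute[OF x])
  then have "h = l *\<^sub>R G x"
  proof (rule single_eigenvalue_imp_scalar)
    show "transpose (G x) = G x" by (rule source.metric_sym[OF x])
    show "0 < v \<bullet> (G x *v v)" if "v \<noteq> 0" for v by (rule G_pos[OF that])
    fix \<kappa> v assume v: "v \<noteq> 0" "h *v v = \<kappa> *\<^sub>R (G x *v v)"
    have "shape_operator G H f x \<xi> *v v = matrix_inv (G x) *v (h *v v)"
      by (simp add: shape_operator_def h_def matrix_vector_mul_assoc)
    also have "\<dots> = \<kappa> *\<^sub>R v"
      unfolding v(2) by (simp add: matrix_vector_mult_scaleR matrix_vector_mul_assoc
          matrix_inv_left[OF G_invertible])
    finally show "\<kappa> = l"
      using v(1) by (intro l) (auto simp: principal_curvatures_def)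
  qed
  moreover have "h $ i $ j = ip x (second_ff G H f x i j) \<xi>" for i j
    by (simp add: h_def ip_def)
  ultimately have ff: "second_ff G H f x i j = (l * G x $ i $ j) *\<^sub>R \<xi>" for i j
    using normal_eq_scaleR_unit_normal[OF x \<xi> second_ff_normal[OF x], of i j] by simp
  \<comment> \<open>Tracing identifies l \<xi> with \<tau> / m, and the choice of \<xi> disappears
    from the result.\<close>
  have "\<tau> x = (\<Sum>i\<in>UNIV. \<Sum>j\<in>UNIV. (matrix_inv (G x) $ i $ j * G x $ i $ j) *\<^sub>R (l *\<^sub>R \<xi>))"
    by (simp add: tension_def ff mult_ac)
  also have "\<dots> = (real CARD('m) * l) *\<^sub>R \<xi>"
    unfolding scaleR_sum_left[symmetric] trace_G by simp
  finally show ?thesis by (simp add: ff)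
qed

text \<open>Every term is linear in \<tau> or its covariant derivatives. These derivatives vanish
  because \<tau> vanishes on an open set, not merely at x.\<close>

lemma bitension_zero:
  assumes "\<And>x. x \<in> U \<Longrightarrow> \<tau> x = 0" "x \<in> U"
  shows "bitension G H f x = 0"
proof -
  have D0: "D i V x = 0" if V: "\<And>x. x \<in> U \<Longrightarrow> V x = 0" and "x \<in> U" for i V x
    using partial_cong[OF source.open_dom \<open>x \<in> U\<close> V] V[OF \<open>x \<in> U\<close>]
    unfolding target.cov_along_eq by simp
  have "D i \<tau> x = 0" if "x \<in> U" for i x
    by (rule D0[OF assms(1) that])
  moreover from this have "D i (D j \<tau>) x = 0" for i j
    by (rule D0[OF _ assms(2)])
  moreover have "curvature H y u 0 w = 0" for y u w
    by (simp add: curvature_def vec_eq_iff)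
  ultimately show ?thesis
    using assms by (simp add: bitension_def Let_def)
qed

subsection \<open>Totally umbilical biharmonic hypersurfaces\<close>

text \<open>The trace over the tangent space is a full Ricci contraction: the normal direction
  \<open>\<tau>\<close> does not contribute because \<open>R(\<tau>, \<tau>) = 0\<close>.\<close>

lemma einstein_curvature_trace:
  assumes x: "x \<in> U" and ric: "ricci H (f x) = c *\<^sub>R H (f x)"
  shows "ip x z (\<Sum>i\<in>UNIV. \<Sum>j\<in>UNIV. matrix_inv (G x) $ i $ j *\<^sub>R
      curvature H (f x) (e i x) (\<tau> x) (e j x)) = - (c * ip x z (\<tau> x))"
proof (cases "\<tau> x = 0")
  \<comment> \<open>Treated separately because \<open>trace_expand\<close>, used with \<tau> as the
    normal vector, divides by its squared length.\<close>
  case True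
  then have "curvature H (f x) u (\<tau> x) w = 0" for u w
    by (simp add: curvature_def vec_eq_iff)
  with True show ?thesis by (simp add: ip_linear)
next
  case False
  let ?R = "curvature H (f x)"
  have anti: "ip x z (?R u v w) = - ip x w (?R u v z)" for u v w z
    unfolding ip_def by (rule target.curvature_antisymmetric[OF maps_into[OF x]])
  have "linear (\<lambda>u. ?R u (\<tau> x) z)"
    by (rule linearI) (simp_all add: target.curvature_add target.curvature_scaleR)
  moreover have "ip x (e i x) (\<tau> x) = 0" for i
    using tension_normal[OF x] ip_commute[OF x] by simp
  ultimately have "trace (matrix (\<lambda>u. ?R u (\<tau> x) z))
      = (\<Sum>i\<in>UNIV. \<Sum>j\<in>UNIV. matrix_inv (G x) $ i $ j * ip x (e j x) (?R (e i x) (\<tau> x) z))"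
    using hyperplane_basis.trace_expand[OF frame[OF x], of "\<tau> x", folded ip_def] False
    by (simp add: target.curvature_same[OF maps_into[OF x]] ip_linear)
  moreover have "trace (matrix (\<lambda>u. ?R u (\<tau> x) z)) = c * ip x (\<tau> x) z"
    unfolding target.ricci_eq[symmetric] ric
    by (simp add: ip_def flip: scaleR_matrix_vector_assoc)
  \<comment> \<open>Here R(e_i, \<tau>) e_j is tested against z, whereas the Ricci trace tests
    R(e_i, \<tau>) z against e_j; \<open>anti\<close> exchanges the two and produces the minus
    sign.\<close>
  ultimately show ?thesis
    by (simp add: ip_linear(6,8) anti[of z] sum_negf ip_commute[OF x, of "\<tau> x" z])
qed

text \<open>\<open>c x\<close> is the Einstein factor r / n at \<open>f x\<close>. The hypotheses
  range over all of U because their consequences are differentiated before being evaluated at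
  x.\<close>

lemma umbilical_biharmonic_imp_tension_zero:
  assumes umb: "\<And>x i j. x \<in> U \<Longrightarrow> second_ff G H f x i j = (G x $ i $ j / real CARD('m)) *\<^sub>R \<tau> x"
    and einstein: "\<And>x. x \<in> U \<Longrightarrow> ricci H (f x) = c x *\<^sub>R H (f x)"
    and nonpos: "\<And>x. x \<in> U \<Longrightarrow> c x \<le> 0"
    and biharmonic: "\<And>x. x \<in> U \<Longrightarrow> bitension G H f x = 0"
    and x: "x \<in> U"
  shows "\<tau> x = 0"
proof -
  define u where "u x = ip x (\<tau> x) (\<tau> x)" for x
  \<comment> \<open>The second covariant derivative of \<tau>; its g-trace is the Laplacian part of
    the bitension field.\<close>
  define S where "S i j x = D i (D j \<tau>) x - (\<Sum>k\<in>UNIV. \<Gamma> x k i j *\<^sub>R D k \<tau> x)" for i j x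
  define m where "m = real CARD('m)"
  have m: "m > 0" by (simp add: m_def)
  have De: "D i (e j) x = (G x $ i $ j / m) *\<^sub>R \<tau> x + (\<Sum>k\<in>UNIV. \<Gamma> x k i j *\<^sub>R e k x)"
    if "x \<in> U" for i j x
    unfolding D_e umb[OF that] m_def ..
  have normal: "ip x (\<tau> x) (e k x) = 0" "ip x (e k x) (\<tau> x) = 0" if "x \<in> U" for k x
    using tension_normal[OF that] ip_commute[OF that] by simp_all
  have smooth_u: "smooth_on U u"
  proof -
    have "smooth_on U (\<lambda>x. H (f x))"
      by (rule smooth_on_compose[OF source.open_dom target.open_dom _ smooth target.smooth_metric])
        (auto intro: maps_into)
    then show ?thesis
      unfolding u_def[abs_def] ip_def
      by (intro smooth_on_inner source.open_dom smooth_tension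
          smooth_on_bounded_bilinear[OF bounded_bilinear_matrix_vector_mult])
  qed
  have Du: "ip x (D i \<tau> x) (\<tau> x) = partial i u x / 2" if "x \<in> U" for i x
    using partial_ip[OF that smooth_tension smooth_tension, of i] ip_commute[OF that, of "\<tau> x"]
    unfolding u_def[abs_def] by simp
  have D\<tau>_e: "ip x (D i \<tau> x) (e j x) = - (G x $ i $ j / m) * u x" if "x \<in> U" for i j x
  proof -
    have "partial i (\<lambda>x. ip x (\<tau> x) (e j x)) x = partial i (\<lambda>x. 0) x"
      by (rule partial_cong[OF source.open_dom that normal(1)])
    then have "ip x (D i \<tau> x) (e j x) + ip x (\<tau> x) (D i (e j) x) = 0"
      by (simp add: partial_ip[OF that smooth_tension smooth_e])
    moreover have "ip x (\<tau> x) (D i (e j) x) = G x $ i $ j / m * u x"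
      by (simp add: De[OF that] ip_linear normal[OF that] u_def)
    ultimately show ?thesis by simp
  qed
  have bitension: "(\<Sum>i\<in>UNIV. \<Sum>j\<in>UNIV. matrix_inv (G x) $ i $ j * ip x (S i j x) z)
      = - (c x * ip x (\<tau> x) z)" if "x \<in> U" for x z
  proof -
    have "(\<Sum>i\<in>UNIV. \<Sum>j\<in>UNIV. matrix_inv (G x) $ i $ j *\<^sub>R S i j x)
      = (\<Sum>i\<in>UNIV. \<Sum>j\<in>UNIV. matrix_inv (G x) $ i $ j *\<^sub>R
          curvature H (f x) (e i x) (\<tau> x) (e j x))"
      using biharmonic[OF that] by (simp add: bitension_def S_def Let_def)
    from arg_cong[OF this, of "ip x z"]
    have "ip x z (\<Sum>i\<in>UNIV. \<Sum>j\<in>UNIV. matrix_inv (G x) $ i $ j *\<^sub>R S i j x)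
        = - (c x * ip x z (\<tau> x))"
      unfolding einstein_curvature_trace[OF that einstein[OF that]] .
    then show ?thesis
      unfolding ip_commute[OF that, of z] by (simp add: ip_linear)
  qed
  \<comment> \<open>Differentiating \<open>D\<tau>_e\<close> once more produces Christoffel terms
    from the derivative of g, from \<open>D i (e k)\<close> and from the correction in S. They
    cancel, and only derivatives of u remain.\<close>
  have S_e: "ip x (S i j x) (e k x)
      = - (G x $ k $ j * partial i u x + G x $ k $ i * partial j u x / 2) / m"
    if "x \<in> U" for i j k x
  proof -
    have "partial i (\<lambda>x. ip x (D j \<tau> x) (e k x)) x = partial i (\<lambda>x. (- 1 / m) * (G x $ j $ k * u x)) x"
      by (rule partial_cong[OF source.open_dom that]) (simp add: D\<tau>_e)
    also have "\<dots> = (- 1 / m) * partial i (\<lambda>x. G x $ j $ k * u x) x"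
    proof (rule partial_bounded_linear[OF bounded_linear_mult_right])
      have "smooth_on U (\<lambda>x. G x $ j $ k)"
        by (rule smooth_on_vec_nth[OF source.open_dom smooth_on_vec_nth[OF source.open_dom
              source.smooth_metric]])
      from smooth_on_mult[OF source.open_dom this smooth_u]
      show "(\<lambda>x. G x $ j $ k * u x) differentiable at x"
        by (rule smooth_on_imp_differentiable[OF _ that])
    qed
    also have "partial i (\<lambda>x. G x $ j $ k * u x) x
        = G x $ j $ k * partial i u x + partial i (\<lambda>x. G x $ j $ k) x * u x"
    proof (rule partial_bounded_bilinear[OF bounded_bilinear_mult])
      show "(\<lambda>x. G x $ j $ k) differentiable at x"
        by (rule smooth_on_imp_differentiable[OF smooth_on_vec_nth[OF source.open_dom
                smooth_on_vec_nth[OF source.open_dom source.smooth_metric]] that])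
    qed (rule smooth_on_imp_differentiable[OF smooth_u that])
    also have "partial i (\<lambda>y. G y $ j $ k) x
        = (\<Sum>l\<in>UNIV. G x $ k $ l * \<Gamma> x l i j) + (\<Sum>l\<in>UNIV. G x $ j $ l * \<Gamma> x l i k)"
      unfolding partial_G[OF that] ip_D_e[OF that] ..
    finally have 1: "ip x (D i (D j \<tau>) x) (e k x) + ip x (D j \<tau> x) (D i (e k) x)
        = (- 1 / m) * (G x $ j $ k * partial i u x
          + ((\<Sum>l\<in>UNIV. G x $ k $ l * \<Gamma> x l i j) + (\<Sum>l\<in>UNIV. G x $ j $ l * \<Gamma> x l i k)) * u x)"
      unfolding partial_ip[OF that smooth_D[OF smooth_tension] smooth_e] .
    have 2: "ip x (D j \<tau> x) (D i (e k) x) = G x $ i $ k / m * (partial j u x / 2)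
        - (\<Sum>l\<in>UNIV. G x $ j $ l * \<Gamma> x l i k) * (u x / m)"
      by (simp add: De[OF that] ip_linear Du[OF that] D\<tau>_e[OF that] sum_distrib_left sum_divide_distrib sum_negf mult_ac)
    have 3: "ip x (\<Sum>l\<in>UNIV. \<Gamma> x l i j *\<^sub>R D l \<tau> x) (e k x)
        = - (\<Sum>l\<in>UNIV. G x $ k $ l * \<Gamma> x l i j) * (u x / m)"
      by (simp add: ip_linear D\<tau>_e[OF that] sum_distrib_left sum_divide_distrib sum_negf mult_ac
          source.metric_nth_commute[OF that, of k])
    show ?thesis
      using 1 unfolding 2 S_def ip_linear(3) 3
        source.metric_nth_commute[OF that, of j k] source.metric_nth_commute[OF that, of i k]
      using m by (simp add: field_simps)
  qed
  have du: "partial k u x = 0" if "x \<in> U" for k x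
  proof -
    interpret hyperplane_basis "H (f x)" "\<lambda>i. e i x" "G x" by (rule frame[OF that])
    let ?g = "matrix_inv (G x)"
    have 1: "(\<Sum>i\<in>UNIV. \<Sum>j\<in>UNIV. ?g $ i $ j * (G x $ k $ j * partial i u x)) = partial k u x"
    proof -
      have "(\<Sum>i\<in>UNIV. \<Sum>j\<in>UNIV. ?g $ i $ j * (G x $ k $ j * partial i u x))
          = (\<Sum>i\<in>UNIV. (\<Sum>j\<in>UNIV. ?g $ i $ j * G x $ j $ k) * partial i u x)"
        unfolding G_commute[of k] by (simp add: sum_distrib_right mult.assoc)
      then show ?thesis
        unfolding matrix_inv_G by (simp add: if_distrib[of "\<lambda>c. c * _"] cong: if_cong)
    qed
    have 2: "(\<Sum>i\<in>UNIV. \<Sum>j\<in>UNIV. ?g $ i $ j * (G x $ k $ i * partial j u x)) = partial k u x"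
    proof -
      have "(\<Sum>i\<in>UNIV. \<Sum>j\<in>UNIV. ?g $ i $ j * (G x $ k $ i * partial j u x))
          = (\<Sum>j\<in>UNIV. (\<Sum>i\<in>UNIV. G x $ k $ i * ?g $ i $ j) * partial j u x)"
        by (subst sum.swap) (simp add: sum_distrib_left sum_distrib_right mult_ac)
      then show ?thesis
        unfolding G_matrix_inv by (simp add: if_distrib[of "\<lambda>c. c * _"] cong: if_cong)
    qed
    \<comment> \<open>Both traces equal the k-th partial derivative of u, with weights 1/m and
      1/(2m), while the curvature side vanishes against the tangent vector.\<close>
    have "(\<Sum>i\<in>UNIV. \<Sum>j\<in>UNIV. ?g $ i $ j * ip x (S i j x) (e k x))
      = - (1 / m) * (\<Sum>i\<in>UNIV. \<Sum>j\<in>UNIV. ?g $ i $ j * (G x $ k $ j * partial i u x))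
        - (1 / (2 * m)) * (\<Sum>i\<in>UNIV. \<Sum>j\<in>UNIV. ?g $ i $ j * (G x $ k $ i * partial j u x))"
      unfolding S_e[OF that] sum_distrib_left sum_subtractf[symmetric]
      using m by (intro sum.cong refl) (simp add: field_simps)
    then have "- (1 / m) * partial k u x - (1 / (2 * m)) * partial k u x = 0"
      unfolding 1 2 bitension[OF that] normal[OF that] by simp
    then show ?thesis using m by (simp add: field_simps)
  qed
  show ?thesis
  proof (rule ccontr)
    assume nz: "\<tau> x \<noteq> 0"
    interpret hyperplane_basis "H (f x)" "\<lambda>i. e i x" "G x" by (rule frame[OF x])
    have u_pos: "0 < u x" unfolding u_def by (rule ip_pos[OF x nz])
    \<comment> \<open>Because du = 0, the derivative of \<tau> has no component along \<tau>, so its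
      known tangential part is all of it.\<close>
    have D\<tau>: "D i \<tau> x = - (u x / m) *\<^sub>R e i x" for i
    proof -
      have "D i \<tau> x + (u x / m) *\<^sub>R e i x = 0"
      proof (rule orthogonal_eq_0[folded ip_def])
        show "ip x (e k x) (\<tau> x) = 0" for k by (rule normal[OF x])
        show "ip x (e k x) (D i \<tau> x + (u x / m) *\<^sub>R e i x) = 0" for k
          unfolding ip_commute[OF x, of "e k x"]
          by (simp add: ip_linear D\<tau>_e[OF x] G_nth[folded ip_def])
        show "ip x (\<tau> x) (D i \<tau> x + (u x / m) *\<^sub>R e i x) = 0"
          unfolding ip_commute[OF x, of "\<tau> x"]
          by (simp add: ip_linear Du[OF x] du[OF x] normal[OF x])
      qed fact
      then show ?thesis by (simp add: eq_neg_iff_add_eq_0)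
    qed
    \<comment> \<open>The product of \<open>D j \<tau>\<close> with \<tau> is half of a partial
      derivative of u, hence zero on all of U. Differentiating it trades the second derivative of
      \<tau> for a product of two first derivatives, and the Christoffel correction in S vanishes
      for the same reason.\<close>
    have S_\<tau>: "ip x (S i j x) (\<tau> x) = - (u x / m)\<^sup>2 * G x $ i $ j" for i j
    proof -
      have "partial i (\<lambda>x. ip x (D j \<tau> x) (\<tau> x)) x = partial i (\<lambda>x. 0) x"
        by (rule partial_cong[OF source.open_dom x]) (simp add: Du du)
      then have "ip x (D i (D j \<tau>) x) (\<tau> x) + ip x (D j \<tau> x) (D i \<tau> x) = 0"
        by (simp add: partial_ip[OF x smooth_D[OF smooth_tension] smooth_tension])
      moreover have "ip x (D j \<tau> x) (D i \<tau> x) = (u x / m)\<^sup>2 * G x $ i $ j"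
        unfolding D\<tau> by (simp add: ip_linear G_nth[folded ip_def] ip_commute[OF x, of "e j x" "e i x"] power2_eq_square)
      ultimately show ?thesis
        by (simp add: S_def ip_linear Du[OF x] du[OF x])
    qed
    have "- (u x / m)\<^sup>2 * (\<Sum>i\<in>UNIV. \<Sum>j\<in>UNIV. matrix_inv (G x) $ i $ j * G x $ i $ j)
        = - (c x * u x)"
      using bitension[OF x, of "\<tau> x"] unfolding S_\<tau> sum_distrib_left u_def[symmetric]
      by (simp only: mult.left_commute)
    \<comment> \<open>The trace of g contributes a factor m, which cancels one of the two in the
      square of u / m.\<close>
    then have "u x * (u x / m) = c x * u x"
      unfolding trace_G[folded m_def] using m by (simp add: power2_eq_square)
    moreover have "0 < u x * (u x / m)" using u_pos m by simp
    moreover have "c x * u x \<le> 0" using nonpos[OF x] u_pos by (simp add: mult_nonpos_nonneg)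
    ultimately show False by simp
  qed
qed

end

subsection \<open>Passage to charts\<close>

lemma local_dom_subset: "local_dom c d \<phi> \<subseteq> chart_image c"
  unfolding local_dom_def chart_image_def by blast

text \<open>The preimage of a chart domain is open by continuity, and a chart is a homeomorphism
  onto an open set, so it carries open subsets of its domain to open sets.\<close>

lemma open_local_dom:
  assumes c: "is_chart X c" and d: "is_chart Y d" and \<phi>: "continuous_map X Y \<phi>"
  shows "open (local_dom c d \<phi>)"
proof -
  have "openin X {p \<in> topspace X. \<phi> p \<in> chart_dom d}"
    using d by (intro openin_continuous_map_preimage[OF \<phi>]) (simp add: is_chart_def)
  moreover have dom: "openin X (chart_dom c)"
    using c by (simp add: is_chart_def)
  ultimately have "openin X (chart_dom c \<inter> {p \<in> topspace X. \<phi> p \<in> chart_dom d})"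
    by (intro openin_Int)
  moreover have "chart_dom c \<inter> {p \<in> topspace X. \<phi> p \<in> chart_dom d} = chart_dom c \<inter> \<phi> -` chart_dom d"
    using openin_subset[OF dom] by blast
  ultimately have "openin (subtopology X (chart_dom c)) (chart_dom c \<inter> \<phi> -` chart_dom d)"
    by (metis inf_le1 openin_open_subtopology dom)
  then have "openin (top_of_set (chart_image c)) (local_dom c d \<phi>)"
    unfolding local_dom_def
    using c homeomorphic_imp_open_map[of "subtopology X (chart_dom c)" "top_of_set (chart_image c)"
        "chart_map c"]
    by (simp add: is_chart_def open_map_def)
  then show ?thesis
    using c openin_open_trans by (auto simp: is_chart_def)
qed

lemma local_rep_in_chart_image:
  assumes c: "is_chart X c" and x: "x \<in> local_dom c d \<phi>"
  shows "local_rep c d \<phi> x \<in> chart_image d"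
proof -
  obtain p where p: "p \<in> chart_dom c" "\<phi> p \<in> chart_dom d" "x = chart_map c p"
    using x by (auto simp: local_dom_def)
  have "chart_dom c \<subseteq> topspace X"
    using c by (simp add: is_chart_def openin_subset)
  then have "inj_on (chart_map c) (chart_dom c)"
    using c homeomorphic_imp_injective_map[of "subtopology X (chart_dom c)"]
    by (auto simp: is_chart_def topspace_subtopology inf.absorb2)
  then have "chart_inv c x = p"
    using p by (simp add: chart_inv_def)
  then show ?thesis
    using p by (simp add: local_rep_def chart_image_def)
qed

lemma local_hypersurface_charts:
  fixes M :: "('a, 'm::finite) riemannian" and N :: "('b, 'n::finite) riemannian"
  assumes M: "riemannian_manifold M" and N: "riemannian_manifold N"
    and \<phi>: "hypersurface M N \<phi>" and c: "c \<in> atlas M" and d: "d \<in> atlas N"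
  shows "local_hypersurface (local_dom c d \<phi>) (metric M c) (chart_image d) (metric N d)
    (local_rep c d \<phi>)"
proof -
  have cc: "is_chart (topology_of M) c" and dd: "is_chart (topology_of N) d"
    using M N c d by (simp_all add: riemannian_manifold_def)
  have cont: "continuous_map (topology_of M) (topology_of N) \<phi>"
    and sm: "smooth_on (local_dom c d \<phi>) (local_rep c d \<phi>)"
    and pb: "\<And>x. x \<in> local_dom c d \<phi> \<Longrightarrow> metric M c x = pullback (metric N d) (local_rep c d \<phi>) x"
    using \<phi> c d by (simp_all add: hypersurface_def isometric_immersion_def smooth_map_def)
  have mM: "smooth_on (chart_image c) (metric M c)"
    "\<And>x. x \<in> chart_image c \<Longrightarrow> transpose (metric M c x) = metric M c x"
    "\<And>x v. x \<in> chart_image c \<Longrightarrow> v \<noteq> 0 \<Longrightarrow> 0 < v \<bullet> (metric M c x *v v)"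
    using M c by (simp_all add: riemannian_manifold_def)
  have mN: "smooth_on (chart_image d) (metric N d)"
    "\<And>x. x \<in> chart_image d \<Longrightarrow> transpose (metric N d x) = metric N d x"
    "\<And>x v. x \<in> chart_image d \<Longrightarrow> v \<noteq> 0 \<Longrightarrow> 0 < v \<bullet> (metric N d x *v v)"
    using N d by (simp_all add: riemannian_manifold_def)
  show ?thesis
  proof
    show "open (local_dom c d \<phi>)" by (rule open_local_dom[OF cc dd cont])
    show "smooth_on (local_dom c d \<phi>) (metric M c)"
      by (rule smooth_on_subset[OF mM(1) local_dom_subset])
    show "open (chart_image d)" using dd by (simp add: is_chart_def)
    show "local_rep c d \<phi> x \<in> chart_image d" if "x \<in> local_dom c d \<phi>" for x
      by (rule local_rep_in_chart_image[OF cc that])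
    show "CARD('n) = CARD('m) + 1" using \<phi> by (simp add: hypersurface_def)
    show "transpose (metric M c x) = metric M c x" if "x \<in> local_dom c d \<phi>" for x
      using that local_dom_subset mM(2) by blast
    show "0 < v \<bullet> (metric M c x *v v)" if "x \<in> local_dom c d \<phi>" "v \<noteq> 0" for x v
      using that local_dom_subset mM(3) by blast
  qed (rule mN sm pb; assumption?)+
qed

theorem theorem2p4:
  fixes M :: "('a, 'm::finite) riemannian"
    and N :: "('b, 'n::finite) riemannian"
    and \<phi> :: "'a \<Rightarrow> 'b"
  assumes "riemannian_manifold M"
    and "einstein_space N"
    and "nonpositive_scalar_curvature N"
    and "hypersurface M N \<phi>"
    and "totally_umbilical M N \<phi>"
  shows "biharmonic M N \<phi> \<longleftrightarrow> minimal M N \<phi>"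
proof -
  have N: "riemannian_manifold N" using assms(2) by (simp add: einstein_space_def)
  have smooth: "smooth_map M N \<phi>"
    using assms(4) by (simp add: hypersurface_def isometric_immersion_def)
  \<comment> \<open>The equivalence holds for each pair of charts on its own, so nothing has to be
    glued.\<close>
  have "(\<forall>x\<in>local_dom c d \<phi>. bitension (metric M c) (metric N d) (local_rep c d \<phi>) x = 0)
      \<longleftrightarrow> (\<forall>x\<in>local_dom c d \<phi>. \<forall>\<xi>. unit_normal (metric N d) (local_rep c d \<phi>) x \<xi> \<longrightarrow>
        mean_curvature (metric M c) (metric N d) (local_rep c d \<phi>) x \<xi> = 0)"
    if c: "c \<in> atlas M" and d: "d \<in> atlas N" for c d
  proof -
    let ?U = "local_dom c d \<phi>" and ?f = "local_rep c d \<phi>"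
    let ?G = "metric M c" and ?H = "metric N d"
    interpret local_hypersurface ?U ?G "chart_image d" ?H ?f
      by (rule local_hypersurface_charts[OF assms(1) N assms(4) c d])
    let ?s = "\<lambda>x. scalar_curvature ?H (?f x) / real CARD('n)"
    have umb: "second_ff ?G ?H ?f x i j = (?G x $ i $ j / real CARD('m)) *\<^sub>R \<tau> x" if "x \<in> ?U" for x i j
      using assms(5) c d that by (intro umbilical_second_ff) (auto simp: totally_umbilical_def)
    have einstein: "ricci ?H (?f x) = ?s x *\<^sub>R ?H (?f x)" if "x \<in> ?U" for x
      using assms(2) d maps_into[OF that] by (simp add: einstein_space_def)
    have nonpos: "?s x \<le> 0" if "x \<in> ?U" for x
      using assms(3) d maps_into[OF that]
      by (simp add: nonpositive_scalar_curvature_def divide_nonpos_pos)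
    have "(\<forall>x\<in>?U. bitension ?G ?H ?f x = 0) \<longleftrightarrow> (\<forall>x\<in>?U. \<tau> x = 0)"
      using umbilical_biharmonic_imp_tension_zero[OF umb einstein nonpos] bitension_zero by blast
    then show ?thesis by (simp add: mean_curvature_zero_iff)
  qed
  then show ?thesis
    unfolding biharmonic_def minimal_def using smooth by blast
qed

end
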